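(* Let $\mathfrak X=(X,\{R_i\}_{i=0}^d)$ be a $Q$-polynomial association scheme with respect to the ordering $E_0,E_1,\dots,E_d$ of its primitive idempotents. For $i\in\{1,\dots,n\}$ let $X_i\subseteq X$ be a $t_i$-design, and assume $X_i\cap X_j=\emptyset$ for distinct $i,j$. For $i,j$ let $A(X_i,X_j)=\{\ell: 1\le\ell\le d,\ R_\ell\cap(X_i\times X_j)\neq\emptyset\}$ and $s_{i,j}=|A(X_i,X_j)|$. If $s_{i,j}+s_{j,h}-2\le t_j$ for all $i,j,h\in\{1,\dots,n\}$, then $Y=\bigcup_{i=1}^nX_i$ with the relations $\{(x,x):x\in X_i\}$ ($1\le i\le n$) and $R_\alpha\cap(X_i\times X_j)$ ($1\le i,j\le n$, $\alpha\in A(X_i,X_j)$) is a $Q$-polynomial coherent configuration.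
   Context: A symmetric association scheme $(X,\{R_i\}_{i=0}^d)$: $X$ finite, $R_0$ the diagonal, $\{R_i\}$ a partition of $X\times X$ into nonempty symmetric relations such that $|\{z:(x,z)\in R_i,(z,y)\in R_j\}|$ depends only on $i,j$ and the $h$ with $(x,y)\in R_h$. Its adjacency algebra has primitive idempotents $E_0=\frac1{|X|}J,E_1,\dots,E_d$, and Krein numbers are defined by $E_i\circ E_j=\frac1{|X|}\sum_h q_{i,j}^hE_h$ ($\circ$ entrywise product). It is $Q$-polynomial w.r.t. this ordering if the matrix $(q_{1,j}^h)_{j,h=0}^d$ is tridiagonal with nonzero super- and subdiagonal entries. A nonempty $C\subseteq X$ is a $t$-design if $E_i\chi_C=0$ for all $1\le i\le t$, $\chi_C$ the characteristic vector of $C$. Coherent configuration: pair $(Y,\mathcal R)$, $\mathcal R$ a partition of $Y\times Y$ into nonempty relations, closed under transpose, each relation meeting the diagonal contained in it, and $|\{z:(x,z)\in R,(z,y)\in R'\}|$ constant on each relation $R''$. Its fibers $Y_i$ are given by the diagonal relations; relations in $Y_i\times Y_j$ are labelled $R^{(i,j)}_\ell$, $\varepsilon_{i,j}\le\ell\le r_{i,j}$ ($\varepsilon_{i,j}=1-\delta_{i,j}$, $R^{(i,i)}_0$ diagonal, $(R^{(i,j)}_\ell)^\top=R^{(j,i)}_\ell$), $\tilde r_{i,j}=r_{i,j}-\varepsilon_{i,j}$, $A^{(i,j)}_\ell$ adjacency matrices, $\mathcal A^{(i,j)}$ their span, $\mathcal A$ the span of all. It is a $Q$-polynomial coherent configuration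 if each fiber is a symmetric association scheme and there is a basis $\{E^{(i,j)}_\ell: 0\le\ell\le\tilde r_{i,j}\}$ of $\mathcal A$ with (B1) $E^{(i,j)}_0=\frac{1}{\sqrt{|Y_i||Y_j|}}\times$(all-ones on $Y_i\times Y_j$, zero elsewhere); (B2) $\{E^{(i,j)}_\ell\}_\ell$ is a basis of $\mathcal A^{(i,j)}$; (B3) $(E^{(i,j)}_\ell)^\top=E^{(j,i)}_\ell$; (B4) $E^{(i,j)}_\ell E^{(i',j')}_{\ell'}=\delta_{\ell,\ell'}\delta_{j,i'}E^{(i,j')}_\ell$; and such that, writing $E^{(i,j)}_\ell\circ E^{(i,j)}_m=\frac{1}{\sqrt{|Y_i||Y_j|}}\sum_nq^{(i,j)}_{\ell,m,n}E^{(i,j)}_n$, every matrix $(q^{(i,j)}_{1,m,n})_{m,n=0}^{\tilde r_{i,j}}$ is tridiagonal with nonzero super- and subdiagonal entries. *)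

theory Defs
  imports "HOL-Analysis.Analysis" "HOL-Library.Disjoint_Sets"
begin

text \<open>
  All point sets are subsets of a finite type 'a, and a matrix indexed by Z x W with
  Z, W subsets of 'a is a real matrix indexed by the whole type that vanishes outside Z x W.
  On this representation the library operations are used as follows: \<open>**\<close> is the matrix product,
  while \<open>*\<close> is the componentwise (hence entrywise, Hadamard) product.
\<close>

definition adjacency :: "('a::finite \<times> 'a) set \<Rightarrow> real^'a^'a" where
  "adjacency S = (\<chi> x y. if (x, y) \<in> S then 1 else 0)"

definition char_vec :: "'a::finite set \<Rightarrow> real^'a" where
  "char_vec C = (\<chi> x. if x \<in> C then 1 else 0)"

definition constant_intersection :: "'a set \<Rightarrow> ('a \<times> 'a) set \<Rightarrow> ('a \<times> 'a) set \<Rightarrow> ('a \<times> 'a) set \<Rightarrow> bool" where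
  "constant_intersection Y S S' S'' \<longleftrightarrow>
     (\<exists>p. \<forall>(x, y) \<in> S''. card {z \<in> Y. (x, z) \<in> S \<and> (z, y) \<in> S'} = p)"

definition sym_assoc_scheme :: "'a::finite set \<Rightarrow> nat \<Rightarrow> (nat \<Rightarrow> ('a \<times> 'a) set) \<Rightarrow> bool" where
  "sym_assoc_scheme X d R \<longleftrightarrow>
     R 0 = Id_on X \<and>
     inj_on R {..d} \<and>
     partition_on (X \<times> X) (R ` {..d}) \<and>
     (\<forall>i\<le>d. sym (R i)) \<and>
     (\<forall>i\<le>d. \<forall>j\<le>d. \<forall>h\<le>d. constant_intersection X (R i) (R j) (R h))"

definition idempotents :: "(real^'a^'a) set \<Rightarrow> (real^'a^'a::finite) set" where
  "idempotents \<A> = {e \<in> \<A>. e ** e = e}"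

definition primitive_idempotents :: "(real^'a^'a) set \<Rightarrow> (real^'a^'a::finite) set" where
  "primitive_idempotents \<A> =
     {e \<in> idempotents \<A>. e \<noteq> 0 \<and>
        (\<forall>f \<in> idempotents \<A>. \<forall>g \<in> idempotents \<A>.
           f ** g = 0 \<and> g ** f = 0 \<and> e = f + g \<longrightarrow> f = 0 \<or> g = 0)}"

definition tridiagonal_nonzero :: "nat \<Rightarrow> (nat \<Rightarrow> nat \<Rightarrow> real) \<Rightarrow> bool" where
  "tridiagonal_nonzero N B \<longleftrightarrow>
     (\<forall>m\<le>N. \<forall>n\<le>N.
        (Suc m < n \<or> Suc n < m \<longrightarrow> B m n = 0) \<and>
        (n = Suc m \<or> m = Suc n \<longrightarrow> B m n \<noteq> 0))"

text \<open>
  The coefficients q are the Krein numbers of \<open>E 0, \<dots>, E N\<close>, normalised by the factor c; they are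
  unique because the matrices \<open>E n\<close> are linearly independent wherever this is used.
  For \<open>N = 0\<close> there is no \<open>E 1\<close>; the matrix in question is then 1 x 1 and the tridiagonality
  condition is void.
\<close>

definition Q_polynomial_basis :: "real \<Rightarrow> nat \<Rightarrow> (nat \<Rightarrow> real^'a^'a::finite) \<Rightarrow> bool" where
  "Q_polynomial_basis c N E \<longleftrightarrow>
     (\<exists>q. (\<forall>l\<le>N. \<forall>m\<le>N. E l * E m = c *\<^sub>R (\<Sum>n\<le>N. q l m n *\<^sub>R E n)) \<and>
          tridiagonal_nonzero N (q 1))"

definition Q_polynomial_scheme ::
  "'a::finite set \<Rightarrow> nat \<Rightarrow> (nat \<Rightarrow> ('a \<times> 'a) set) \<Rightarrow> (nat \<Rightarrow> real^'a^'a) \<Rightarrow> bool" where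
  "Q_polynomial_scheme X d R E \<longleftrightarrow>
     sym_assoc_scheme X d R \<and>
     bij_betw E {..d} (primitive_idempotents (span (adjacency ` R ` {..d}))) \<and>
     E 0 = (1 / real (card X)) *\<^sub>R adjacency (X \<times> X) \<and>
     Q_polynomial_basis (1 / real (card X)) d E"

text \<open>
  There are no idempotents beyond \<open>E d\<close>, so for \<open>t > d\<close> the condition is the same as for \<open>t = d\<close>.
\<close>

definition is_design ::
  "'a::finite set \<Rightarrow> nat \<Rightarrow> (nat \<Rightarrow> real^'a^'a) \<Rightarrow> nat \<Rightarrow> 'a set \<Rightarrow> bool" where
  "is_design X d E t C \<longleftrightarrow>
     C \<noteq> {} \<and> C \<subseteq> X \<and> (\<forall>i\<in>{1..d}. i \<le> t \<longrightarrow> E i *v char_vec C = 0)"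

definition rel_indices :: "nat \<Rightarrow> (nat \<Rightarrow> ('a \<times> 'a) set) \<Rightarrow> 'a set \<Rightarrow> 'a set \<Rightarrow> nat set" where
  "rel_indices d R Z W = {l \<in> {1..d}. R l \<inter> (Z \<times> W) \<noteq> {}}"

definition coherent_configuration :: "'a::finite set \<Rightarrow> ('a \<times> 'a) set set \<Rightarrow> bool" where
  "coherent_configuration Y \<R> \<longleftrightarrow>
     partition_on (Y \<times> Y) \<R> \<and>
     (\<forall>S\<in>\<R>. S\<inverse> \<in> \<R>) \<and>
     (\<forall>S\<in>\<R>. S \<inter> Id \<noteq> {} \<longrightarrow> S \<subseteq> Id) \<and>
     (\<forall>S\<in>\<R>. \<forall>S'\<in>\<R>. \<forall>S''\<in>\<R>. constant_intersection Y S S' S'')"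

definition fibers :: "('a \<times> 'a) set set \<Rightarrow> 'a set set" where
  "fibers \<R> = {Z. Z \<noteq> {} \<and> Id_on Z \<in> \<R>}"

definition rels_between :: "('a \<times> 'a) set set \<Rightarrow> 'a set \<Rightarrow> 'a set \<Rightarrow> ('a \<times> 'a) set set" where
  "rels_between \<R> Z W = {S \<in> \<R>. S \<subseteq> Z \<times> W}"

text \<open>
  With the relations between the i-th and the j-th fiber labelled by
  \<open>\<epsilon>\<^sub>i\<^sub>j, \<dots>, r\<^sub>i\<^sub>j\<close>, their number is \<open>r\<^sub>i\<^sub>j - \<epsilon>\<^sub>i\<^sub>j + 1\<close>, so the following is \<open>r\<^sub>i\<^sub>j - \<epsilon>\<^sub>i\<^sub>j\<close>.
\<close>

definition r_tilde :: "('a \<times> 'a) set set \<Rightarrow> 'a set \<Rightarrow> 'a set \<Rightarrow> nat" where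
  "r_tilde \<R> Z W = card (rels_between \<R> Z W) - 1"

definition family_basis :: "('i \<Rightarrow> 'v::real_vector) \<Rightarrow> 'i set \<Rightarrow> 'v set \<Rightarrow> bool" where
  "family_basis f I V \<longleftrightarrow> inj_on f I \<and> independent (f ` I) \<and> span (f ` I) = V"

text \<open>
  The matrices are indexed by the fibers themselves rather than by numbers of fibers:
  \<open>E Z W l\<close> stands for the l-th basis element belonging to the pair of fibers \<open>(Z, W)\<close>, and only
  the values with \<open>l \<le> r_tilde \<R> Z W\<close> matter. The conjunct next to the product rule says that
  the matrix on the right-hand side is again one of the basis elements.
\<close>

definition Q_polynomial_coherent_configuration :: "'a::finite set \<Rightarrow> ('a \<times> 'a) set set \<Rightarrow> bool" where
  "Q_polynomial_coherent_configuration Y \<R> \<longleftrightarrow>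
     coherent_configuration Y \<R> \<and>
     (\<forall>Z\<in>fibers \<R>. \<exists>d R. sym_assoc_scheme Z d R \<and> R ` {..d} = rels_between \<R> Z Z) \<and>
     (\<exists>E :: 'a set \<Rightarrow> 'a set \<Rightarrow> nat \<Rightarrow> real^'a^'a.
        family_basis (\<lambda>(Z, W, l). E Z W l)
          {(Z, W, l). Z \<in> fibers \<R> \<and> W \<in> fibers \<R> \<and> l \<le> r_tilde \<R> Z W}
          (span (adjacency ` \<R>)) \<and>
        (\<forall>Z\<in>fibers \<R>. \<forall>W\<in>fibers \<R>.
           E Z W 0 = (1 / sqrt (real (card Z) * real (card W))) *\<^sub>R adjacency (Z \<times> W)) \<and>
        (\<forall>Z\<in>fibers \<R>. \<forall>W\<in>fibers \<R>.
           family_basis (E Z W) {..r_tilde \<R> Z W} (span (adjacency ` rels_between \<R> Z W))) \<and>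
        (\<forall>Z\<in>fibers \<R>. \<forall>W\<in>fibers \<R>. \<forall>l\<le>r_tilde \<R> Z W.
           transpose (E Z W l) = E W Z l) \<and>
        (\<forall>Z\<in>fibers \<R>. \<forall>W\<in>fibers \<R>. \<forall>Z'\<in>fibers \<R>. \<forall>W'\<in>fibers \<R>.
           \<forall>l\<le>r_tilde \<R> Z W. \<forall>l'\<le>r_tilde \<R> Z' W'.
             E Z W l ** E Z' W' l' = (if l = l' \<and> W = Z' then E Z W' l else 0) \<and>
             (l = l' \<and> W = Z' \<longrightarrow> l \<le> r_tilde \<R> Z W')) \<and>
        (\<forall>Z\<in>fibers \<R>. \<forall>W\<in>fibers \<R>.
           Q_polynomial_basis (1 / sqrt (real (card Z) * real (card W))) (r_tilde \<R> Z W) (E Z W)))"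

end

theory Submission
  imports Defs "HOL-Computational_Algebra.Polynomial"
begin

text \<open>
  Let \<open>\<Delta>\<^sub>Z\<close> be the diagonal projection onto a fiber \<open>Z\<close>. If \<open>C\<close> is a t-design and \<open>k + l \<le> t\<close>, then
  \<open>E\<^sub>k \<Delta>\<^sub>C E\<^sub>l = \<delta>\<^sub>k\<^sub>l (|C| / |X|) E\<^sub>k\<close>, because \<open>E\<^sub>k \<circ> E\<^sub>l\<close> only involves \<open>E\<^sub>0, \<dots>, E\<^sub>k\<^sub>+\<^sub>l\<close>, which determines
  the Frobenius norm of the difference of both sides. So the matrices
  \<open>|X| / sqrt (|Z||W|) \<Delta>\<^sub>Z E\<^sub>l \<Delta>\<^sub>W\<close> with \<open>l < s(Z, W)\<close> multiply like matrix units; in each diagonal block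
  the complement of their sum is one more idempotent.

  The \<open>E\<^sub>l\<close> are polynomials of degree \<open>l\<close> in \<open>E\<^sub>1\<close> with respect to the entrywise product, and \<open>E\<^sub>1\<close>
  separates the relations. On a block with \<open>N\<close> relations, a polynomial of degree less than \<open>N\<close> in \<open>E\<^sub>1\<close>
  vanishes only if it is zero, so the matrices above form an orthogonal basis of the block that is
  graded by the degree. Closure under products gives the coherent configuration. Since the coefficients
  \<open>\<langle>F\<^sub>1 \<circ> F\<^sub>m, F\<^sub>n\<rangle>\<close> are symmetric in m and n, the grading gives tridiagonality.
\<close>

section \<open>Matrices and adjacency algebras\<close>

lemma inner_matrix_trace:
  fixes A B :: "real^'n^'m"
  shows "A \<bullet> B = trace (A ** transpose B)"
  by (simp add: inner_vec_def trace_def matrix_matrix_mult_def transpose_def)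

lemma matrix_mult_diff_right: "A ** (B - C) = A ** B - A ** C"
  and matrix_mult_diff_left: "(B' - C') ** A' = B' ** A' - C' ** A'"
  for A :: "real^'n^'m" and A' :: "real^'k^'n"
  by (simp_all add: vec_eq_iff matrix_matrix_mult_def sum_subtractf algebra_simps)

lemma matrix_mult_scaleR_right: "A ** (c *\<^sub>R B) = c *\<^sub>R (A ** B)"
  and matrix_mult_scaleR_left: "(c *\<^sub>R A) ** B = c *\<^sub>R (A ** B)"
  for A :: "real^'n^'m"
  by (simp_all add: vec_eq_iff matrix_matrix_mult_def sum_distrib_left algebra_simps)

lemma matrix_mult_sum_right: "A ** (\<Sum>i\<in>I. B i) = (\<Sum>i\<in>I. A ** B i)"
  and matrix_mult_sum_left: "(\<Sum>i\<in>I. B' i) ** A' = (\<Sum>i\<in>I. B' i ** A')"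
  for A :: "real^'n^'m" and A' :: "real^'k^'n"
  by (induction I rule: infinite_finite_induct)
    (simp_all add: vec_eq_iff matrix_matrix_mult_def sum.distrib algebra_simps)

lemma adjacency_nth [simp]: "adjacency S $ x $ y = (if (x, y) \<in> S then 1 else 0)"
  by (simp add: adjacency_def)

lemma sum_matrix_nth: "(\<Sum>i\<in>I. M i) $ x $ y = (\<Sum>i\<in>I. M i $ x $ y)"
  by (induction I rule: infinite_finite_induct) auto

lemma adjacency_mult_nth:
  "(adjacency S ** adjacency S') $ x $ y = real (card {z. (x, z) \<in> S \<and> (z, y) \<in> S'})"
proof -
  have "(adjacency S ** adjacency S') $ x $ y = (\<Sum>z\<in>UNIV. if (x, z) \<in> S \<and> (z, y) \<in> S' then 1 else 0)"
    by (auto simp: matrix_matrix_mult_def intro!: sum.cong)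
  then show ?thesis by (simp flip: sum.inter_filter)
qed

text \<open>Supports of distinct relations do not overlap, so a linear combination takes the value
  of one coefficient on each relation. This entrywise form later turns closure of a span under
  products into constancy of intersection numbers.\<close>

lemma mem_span_adjacency:
  fixes P :: "('a::finite \<times> 'a) set set"
  assumes P: "disjoint P"
  shows "M \<in> span (adjacency ` P) \<longleftrightarrow>
    (\<forall>S\<in>P. \<exists>c. \<forall>(x, y)\<in>S. M $ x $ y = c) \<and> (\<forall>x y. (x, y) \<notin> \<Union>P \<longrightarrow> M $ x $ y = 0)"
    (is "_ \<longleftrightarrow> ?Q M")
proof
  assume "M \<in> span (adjacency ` P)"
  then show "?Q M"
  proof (induction rule: span_induct_alt)
    case base
    show ?case by auto
  next
    case (step c B N)
    then obtain S where S: "S \<in> P" "B = adjacency S" by auto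
    have "\<exists>a. \<forall>(x, y)\<in>S'. B $ x $ y = a" if "S' \<in> P" for S'
      using S that disjointD[OF P, of S S']
      by (intro exI[of _ "if S = S' then 1 else 0"]) auto
    moreover have "\<exists>a. \<forall>(x, y)\<in>S'. N $ x $ y = a" if "S' \<in> P" for S'
      using step that by auto
    ultimately have "\<exists>a. \<forall>(x, y)\<in>S'. (c *\<^sub>R B + N) $ x $ y = a" if "S' \<in> P" for S'
      using that by (fastforce simp: split_beta)
    then show ?case using S step by auto
  qed
next
  assume Q: "?Q M"
  then obtain c where c: "\<And>S x y. S \<in> P \<Longrightarrow> (x, y) \<in> S \<Longrightarrow> M $ x $ y = c S"
    by (simp add: Ball_def split_beta) metis
  have "M = (\<Sum>S\<in>P. c S *\<^sub>R adjacency S)"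
  proof (intro vec_eq_iff[THEN iffD2] allI)
    fix x y
    show "M $ x $ y = (\<Sum>S\<in>P. c S *\<^sub>R adjacency S) $ x $ y"
    proof (cases "(x, y) \<in> \<Union>P")
      case True
      then obtain S where S: "S \<in> P" "(x, y) \<in> S" by auto
      have "(\<Sum>S'\<in>P. c S' *\<^sub>R adjacency S') $ x $ y = (\<Sum>S'\<in>P. if S' = S then c S else 0)"
        unfolding sum_matrix_nth using S disjointD[OF P]
        by (intro sum.cong) (auto simp: disjoint_iff)
      then show ?thesis using S c by simp
    next
      case False
      then show ?thesis using Q by (auto simp: sum_matrix_nth intro!: sum.neutral)
    qed
  qed
  then show "M \<in> span (adjacency ` P)"
    by (metis (no_types, lifting) imageI span_base span_scale span_sum)
qed

lemma orthogonal_family_independent: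
  fixes f :: "'i \<Rightarrow> 'v::euclidean_space"
  assumes "\<And>i j. \<lbrakk>i \<in> I; j \<in> I; i \<noteq> j\<rbrakk> \<Longrightarrow> f i \<bullet> f j = 0" "\<And>i. i \<in> I \<Longrightarrow> f i \<noteq> 0"
  shows "inj_on f I" "independent (f ` I)"
proof -
  show "inj_on f I"
    using assms by (metis inj_onI inner_eq_zero_iff)
  show "independent (f ` I)"
    using assms by (intro pairwise_orthogonal_independent) (auto simp: pairwise_def orthogonal_def)
qed

text \<open>Matrices with disjoint nonempty supports are nonzero and pairwise orthogonal for the
  Frobenius inner product.\<close>

lemma dim_span_adjacency:
  fixes P :: "('a::finite \<times> 'a) set set"
  assumes P: "disjoint P" "{} \<notin> P"
  shows "dim (span (adjacency ` P)) = card P"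
proof -
  have nz: "adjacency S \<noteq> 0" if "S \<in> P" for S
  proof -
    have "S \<noteq> {}" using P(2) that by blast
    then obtain x y where "(x, y) \<in> S" by auto
    then have "adjacency S $ x $ y \<noteq> 0" by simp
    then show ?thesis by (metis zero_index)
  qed
  have ort: "adjacency S \<bullet> adjacency S' = 0" if "S \<in> P" "S' \<in> P" "S \<noteq> S'" for S S'
    using disjointD[OF P(1) that] by (auto simp: inner_vec_def intro!: sum.neutral)
  have ind: "inj_on adjacency P" "independent (adjacency ` P)"
    by (rule orthogonal_family_independent; simp add: nz ort)+
  show ?thesis using dim_eq_card_independent[OF ind(2)] card_image[OF ind(1)] by simp
qed

lemma span_mult_closed:
  fixes A :: "(real^'n^'m) set" and B :: "(real^'p^'n) set"
  assumes "\<And>a b. a \<in> A \<Longrightarrow> b \<in> B \<Longrightarrow> a ** b \<in> span C"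
    and "M \<in> span A" "N \<in> span B"
  shows "M ** N \<in> span C"
  using assms(2)
proof (induction rule: span_induct_alt)
  case base
  show ?case by (simp add: span_zero)
next
  case (step c a M')
  from assms(3) have "a ** N \<in> span C"
  proof (induction rule: span_induct_alt)
    case base
    show ?case by (simp add: span_zero)
  next
    case (step c' b N')
    have "a ** (c' *\<^sub>R b + N') = c' *\<^sub>R (a ** b) + a ** N'"
      by (simp add: vec_eq_iff matrix_matrix_mult_def sum.distrib sum_distrib_left algebra_simps)
    then show ?case using step assms(1) \<open>a \<in> A\<close> by (simp add: span_add span_scale)
  qed
  moreover have "(c *\<^sub>R a + M') ** N = c *\<^sub>R (a ** N) + M' ** N"
    
    by (simp add: vec_eq_iff matrix_matrix_mult_def sum.distrib sum_distrib_left algebra_simps)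
  ultimately show ?case using step by (simp add: span_add span_scale)
qed

lemma mem_span_image_finite:
  assumes "finite I" and "v \<in> span (f ` I)"
  shows "\<exists>a. v = (\<Sum>i\<in>I. a i *\<^sub>R f i)"
  using assms(2)
proof (induction rule: span_induct_alt)
  case base
  show ?case by (intro exI[of _ "\<lambda>_. 0"]) simp
next
  case (step c x y)
  then obtain i a where i: "i \<in> I" "x = f i" and a: "y = (\<Sum>i\<in>I. a i *\<^sub>R f i)" by auto
  have "c *\<^sub>R x + y = (\<Sum>j\<in>I. (if j = i then c else 0) *\<^sub>R f j) + y"
    using i assms(1) by (simp add: if_distrib[of "\<lambda>c. c *\<^sub>R _"] cong: if_cong)
  also have "\<dots> = (\<Sum>j\<in>I. (a j + (if j = i then c else 0)) *\<^sub>R f j)"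
    by (simp add: a sum.distrib scaleR_left_distrib)
  finally show ?case by (intro exI)
qed

text \<open>It serves for the matrices \<open>G\<close>, whose independence comes from polynomial
  degrees rather than from orthogonality. Injectivity is part of the conclusion because
  \<open>independent\<close> speaks of sets and does not see repetitions.\<close>

lemma independent_family:
  assumes "finite I" and indep: "\<And>a. (\<Sum>i\<in>I. a i *\<^sub>R f i) = 0 \<Longrightarrow> \<forall>i\<in>I. a i = 0"
  shows "inj_on f I" "independent (f ` I)"
proof -
  show inj: "inj_on f I"
  proof (rule inj_onI, rule ccontr)
    fix i j assume ij: "i \<in> I" "j \<in> I" "f i = f j" "i \<noteq> j"
    \<comment> \<open>The difference of the \<open>i\<close>-th and \<open>j\<close>-th unit
      coefficient vectors is a nontrivial relation if two members coincide.\<close>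
    define a where "a k = (if k = i then 1 else 0) - (if k = j then 1 else (0::real))" for k
    have "(\<Sum>k\<in>I. a k *\<^sub>R f k) = (\<Sum>k\<in>I. (if k = i then f i else 0) - (if k = j then f j else 0))"
      by (intro sum.cong) (auto simp: a_def)
    also have "\<dots> = 0" using ij assms(1) by (simp add: sum_subtractf)
    finally have "a i = 0" using indep ij by blast
    then show False using ij by (simp add: a_def)
  qed
  show "independent (f ` I)"
  proof (rule independent_if_scalars_zero)
    fix u v assume u: "(\<Sum>w\<in>f ` I. u w *\<^sub>R w) = 0" and v: "v \<in> f ` I"
    have "(\<Sum>i\<in>I. u (f i) *\<^sub>R f i) = 0" using u by (simp add: sum.reindex[OF inj])
    then show "u v = 0" using indep[of "\<lambda>i. u (f i)"] v by auto
  qed (use assms in simp)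
qed

lemma mult_Id_on_right_nth: "(M ** adjacency (Id_on C)) $ x $ y = (if y \<in> C then M $ x $ y else 0)"
  and mult_Id_on_left_nth: "(adjacency (Id_on C) ** M') $ y $ x = (if y \<in> C then M' $ y $ x else 0)"
proof -
  have "(M ** adjacency (Id_on C)) $ x $ y = (\<Sum>z\<in>UNIV. if z = y then (if y \<in> C then M $ x $ y else 0) else 0)"
    unfolding matrix_matrix_mult_def vec_lambda_beta by (rule sum.cong) auto
  then show "(M ** adjacency (Id_on C)) $ x $ y = (if y \<in> C then M $ x $ y else 0)" by simp
  have "(adjacency (Id_on C) ** M') $ y $ x = (\<Sum>z\<in>UNIV. if z = y then (if y \<in> C then M' $ y $ x else 0) else 0)"
    unfolding matrix_matrix_mult_def vec_lambda_beta by (rule sum.cong) auto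
  then show "(adjacency (Id_on C) ** M') $ y $ x = (if y \<in> C then M' $ y $ x else 0)" by simp
qed

lemma inner_adjacency_Times: "M \<bullet> adjacency (A \<times> B) = (\<Sum>x\<in>A. \<Sum>y\<in>B. M $ x $ y)"
proof -
  have "M \<bullet> adjacency (A \<times> B) = (\<Sum>x\<in>UNIV. if x \<in> A then \<Sum>y\<in>UNIV. if y \<in> B then M $ x $ y else 0 else 0)"
    unfolding inner_vec_def by (auto intro!: sum.cong sum.neutral)
  then show ?thesis by (simp flip: sum.inter_filter)
qed

text \<open>Induction on the degree bound, splitting off the multiple of \<open>p k\<close> that
  matches the top coefficient. The value of \<open>a k\<close> is recorded because its nonvanishing
  later yields the nonzero entries next to the diagonal.\<close>

lemma poly_graded_basis:
  fixes p :: "nat \<Rightarrow> 'b::field poly"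
  assumes "\<And>j. j \<le> k \<Longrightarrow> degree (p j) = j \<and> p j \<noteq> 0" and "degree f \<le> k"
  shows "\<exists>a. f = (\<Sum>j\<le>k. smult (a j) (p j)) \<and> a k = coeff f k / lead_coeff (p k)"
  using assms
proof (induction k arbitrary: f)
  case 0
  then obtain b where b: "f = [:b:]" by (metis degree_eq_zeroE le_zero_eq)
  from 0 obtain b' where b': "p 0 = [:b':]" by (metis degree_eq_zeroE le_zero_eq)
  have "b' \<noteq> 0" using 0 b' by auto
  then show ?case using b b' by (intro exI[of _ "\<lambda>_. b / b'"]) auto
next
  case (Suc k)
  define c where "c = coeff f (Suc k) / lead_coeff (p (Suc k))"
  define g where "g = f - smult c (p (Suc k))"
  have pk: "degree (p (Suc k)) = Suc k" "p (Suc k) \<noteq> 0" using Suc.prems(1)[of "Suc k"] by auto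
  have "coeff g (Suc k) = 0"
    using pk by (simp add: g_def c_def) (metis leading_coeff_0_iff pk(1) nonzero_eq_divide_eq)
  moreover have "degree g \<le> Suc k"
    unfolding g_def using Suc.prems(2) pk by (intro degree_diff_le) auto
  ultimately have "degree g \<le> k"
    by (metis eq_zero_or_degree_less degree_0 le_SucE le_zero_eq leading_coeff_0_iff zero_le)
  then obtain a where a: "g = (\<Sum>j\<le>k. smult (a j) (p j))"
    using Suc.IH[of g] Suc.prems(1) by auto
  have "f = (\<Sum>j\<le>Suc k. smult ((a(Suc k := c)) j) (p j))"
    using a by (simp add: g_def algebra_simps)
  then show ?case by (intro exI[of _ "a(Suc k := c)"]) (simp add: c_def)
qed

section \<open>The Bose-Mesner algebra\<close>

locale Q_scheme =
  fixes X :: "'a::finite set"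
    and d :: nat
    and R :: "nat \<Rightarrow> ('a \<times> 'a) set"
    and E :: "nat \<Rightarrow> real^'a^'a"
  assumes Q_scheme: "Q_polynomial_scheme X d R E"
begin

abbreviation BM :: "(real^'a^'a) set" where
  "BM \<equiv> span (adjacency ` R ` {..d})"

lemma R_0: "R 0 = Id_on X"
  and R_inj: "inj_on R {..d}"
  and R_partition: "partition_on (X \<times> X) (R ` {..d})"
  and R_sym: "i \<le> d \<Longrightarrow> sym (R i)"
  and R_const: "\<lbrakk>i \<le> d; j \<le> d; h \<le> d\<rbrakk> \<Longrightarrow> constant_intersection X (R i) (R j) (R h)"
  and E_bij: "bij_betw E {..d} (primitive_idempotents BM)"
  and E_0: "E 0 = (1 / real (card X)) *\<^sub>R adjacency (X \<times> X)"
  and E_Q: "Q_polynomial_basis (1 / real (card X)) d E"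
  using Q_scheme by (auto simp: Q_polynomial_scheme_def sym_assoc_scheme_def)

lemma R_subset: "i \<le> d \<Longrightarrow> R i \<subseteq> X \<times> X"
  using partition_onD1[OF R_partition] by auto

lemma R_nonempty: "i \<le> d \<Longrightarrow> R i \<noteq> {}"
  using partition_onD3[OF R_partition] by auto

lemma R_disjoint: "\<lbrakk>i \<le> d; j \<le> d; i \<noteq> j\<rbrakk> \<Longrightarrow> R i \<inter> R j = {}"
  using disjointD[OF partition_onD2[OF R_partition], of "R i" "R j"] R_inj
  by (auto dest: inj_onD)

lemma R_ex: "\<lbrakk>x \<in> X; y \<in> X\<rbrakk> \<Longrightarrow> \<exists>i\<le>d. (x, y) \<in> R i"
proof -
  assume "x \<in> X" "y \<in> X"
  then have "(x, y) \<in> \<Union> (R ` {..d})" using partition_onD1[OF R_partition] by auto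
  then show ?thesis by auto
qed

lemma X_nonempty [simp]: "X \<noteq> {}"
  using R_nonempty[of 0] R_0 by auto

lemma mem_BM:
  "M \<in> BM \<longleftrightarrow> (\<forall>i\<le>d. \<exists>c. \<forall>(x, y)\<in>R i. M $ x $ y = c) \<and> (\<forall>x y. (x, y) \<notin> X \<times> X \<longrightarrow> M $ x $ y = 0)"
  using mem_span_adjacency[OF partition_onD2[OF R_partition], of M] partition_onD1[OF R_partition]
  by auto

lemma BM_const: "\<lbrakk>M \<in> BM; i \<le> d; (x, y) \<in> R i; (x', y') \<in> R i\<rbrakk> \<Longrightarrow> M $ x $ y = M $ x' $ y'"
proof -
  assume "M \<in> BM" and i: "i \<le> d" and R: "(x, y) \<in> R i" "(x', y') \<in> R i"
  then obtain c where c: "\<forall>(x, y)\<in>R i. M $ x $ y = c" unfolding mem_BM by blast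
  show ?thesis using bspec[OF c R(1)] bspec[OF c R(2)] by simp
qed

lemma BM_outside: "\<lbrakk>M \<in> BM; x \<notin> X \<or> y \<notin> X\<rbrakk> \<Longrightarrow> M $ x $ y = 0"
  using mem_BM[of M] by auto

lemma dim_BM: "dim BM = Suc d"
  using dim_span_adjacency[OF partition_onD2[OF R_partition] partition_onD3[OF R_partition]] R_inj
  by (simp add: card_image)

lemma BM_sym: assumes "M \<in> BM" shows "M $ x $ y = M $ y $ x"
proof (cases "x \<in> X \<and> y \<in> X")
  case True
  then obtain i where i: "i \<le> d" "(x, y) \<in> R i" using R_ex by blast
  then have "(y, x) \<in> R i" using R_sym by (auto dest: symD)
  then show ?thesis using BM_const[OF assms i] by simp
qed (use BM_outside[OF assms] in auto)

lemma BM_transpose: "M \<in> BM \<Longrightarrow> transpose M = M"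
  using BM_sym[of M] by (simp add: vec_eq_iff transpose_def)

lemma adjacency_R_mult: assumes "i \<le> d" "j \<le> d" shows "adjacency (R i) ** adjacency (R j) \<in> BM"
proof -
  have "\<exists>c. \<forall>(x, y)\<in>R h. (adjacency (R i) ** adjacency (R j)) $ x $ y = c" if "h \<le> d" for h
  proof -
    obtain c where c: "\<forall>(x, y)\<in>R h. card {z \<in> X. (x, z) \<in> R i \<and> (z, y) \<in> R j} = c"
      using R_const[OF assms \<open>h \<le> d\<close>] unfolding constant_intersection_def by blast
    moreover have "{z. (x, z) \<in> R i \<and> (z, y) \<in> R j} = {z \<in> X. (x, z) \<in> R i \<and> (z, y) \<in> R j}" for x y
      using R_subset assms by blast
    ultimately show ?thesis by (auto simp: adjacency_mult_nth intro!: exI[of _ "real c"])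
  qed
  moreover have "{z. (x, z) \<in> R i \<and> (z, y) \<in> R j} = {}" if "(x, y) \<notin> X \<times> X" for x y
    using that R_subset assms by blast
  ultimately show ?thesis by (auto simp: mem_BM adjacency_mult_nth)
qed

lemma BM_mult: "\<lbrakk>M \<in> BM; N \<in> BM\<rbrakk> \<Longrightarrow> M ** N \<in> BM"
  by (rule span_mult_closed) (auto intro: adjacency_R_mult)

text \<open>The product lies in the algebra and is therefore symmetric, while transposing it
  reverses the two symmetric factors.\<close>

lemma BM_commute: assumes "M \<in> BM" "N \<in> BM" shows "M ** N = N ** M"
  using BM_transpose[OF BM_mult[OF assms]] assms
  by (simp add: matrix_transpose_mul BM_transpose)

section \<open>Orthogonality and completeness of the primitive idempotents\<close>

lemma E_primitive: "l \<le> d \<Longrightarrow> E l \<in> primitive_idempotents BM"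
  using E_bij by (auto simp: bij_betw_def)

lemma E_BM: "l \<le> d \<Longrightarrow> E l \<in> BM"
  and E_idem: "l \<le> d \<Longrightarrow> E l ** E l = E l"
  and E_nz: "l \<le> d \<Longrightarrow> E l \<noteq> 0"
  using E_primitive by (auto simp: primitive_idempotents_def idempotents_def)

text \<open>The two idempotents commute, so \<open>e = e ** f + (e - e ** f)\<close> splits
  \<open>e\<close> into orthogonal idempotents of the algebra. Primitivity of \<open>e\<close> makes
  one summand vanish.\<close>

lemma primitive_absorbs:
  assumes e: "e \<in> primitive_idempotents BM" and f: "f \<in> primitive_idempotents BM"
  shows "e ** f = 0 \<or> e ** f = e"
proof -
  have B: "e \<in> BM" "f \<in> BM" "e ** e = e" "f ** f = f"
    using e f by (auto simp: primitive_idempotents_def idempotents_def)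
  define g where "g = e ** f"
  have gB: "g \<in> BM" by (simp add: g_def B BM_mult)
  have c: "f ** e = g" using BM_commute[OF B(1,2)] by (simp add: g_def)
  have eg: "e ** g = g" by (simp add: g_def matrix_mul_assoc B)
  have ge: "g ** e = g" using BM_commute[OF B(1) gB] eg by simp
  have "f ** g = g" unfolding c[symmetric] by (simp add: matrix_mul_assoc B)
  then have gg: "g ** g = g" using eg unfolding g_def by (simp flip: matrix_mul_assoc)
  have "g \<in> idempotents BM" "e - g \<in> idempotents BM"
    using B gB gg eg ge
    by (auto simp: idempotents_def span_diff matrix_mult_diff_right matrix_mult_diff_left)
  moreover have "g ** (e - g) = 0" "(e - g) ** g = 0"
    using eg ge gg by (auto simp: matrix_mult_diff_right matrix_mult_diff_left)
  moreover have "e = g + (e - g)" by simp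
  ultimately have "g = 0 \<or> e - g = 0"
    using e unfolding primitive_idempotents_def by blast
  then show ?thesis by (auto simp: g_def)
qed

text \<open>If the product did not vanish, absorption in both orders would give
  \<open>E k = E k ** E l = E l ** E k = E l\<close>, against the injectivity of the
  enumeration.\<close>

lemma E_mult: assumes "k \<le> d" "l \<le> d" shows "E k ** E l = (if k = l then E k else 0)"
proof (cases "k = l")
  case False
  then have ne: "E k \<noteq> E l" using E_bij assms by (auto simp: bij_betw_def dest: inj_onD)
  have "E k ** E l = E l ** E k" using BM_commute E_BM assms by blast
  then have "E k ** E l = 0"
    using primitive_absorbs[OF E_primitive[OF assms(1)] E_primitive[OF assms(2)]]
      primitive_absorbs[OF E_primitive[OF assms(2)] E_primitive[OF assms(1)]] ne by auto
  then show ?thesis using False by simp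
qed (use E_idem assms in simp)

lemma E_inner: "\<lbrakk>k \<le> d; l \<le> d; k \<noteq> l\<rbrakk> \<Longrightarrow> E k \<bullet> E l = 0"
  by (simp add: inner_matrix_trace BM_transpose E_BM E_mult trace_def)

text \<open>The \<open>E l\<close> are \<open>d + 1\<close> nonzero, pairwise orthogonal elements of
  a space of dimension \<open>d + 1\<close>.\<close>

lemma span_E: "span (E ` {..d}) = BM"
proof -
  have inj: "inj_on E {..d}" using E_bij by (simp add: bij_betw_def)
  have "independent (E ` {..d})"
    using E_nz E_inner
    by (intro pairwise_orthogonal_independent) (auto simp: pairwise_def orthogonal_def)
  then have "dim (span (E ` {..d})) = dim BM"
    using dim_BM dim_eq_card_independent[of "E ` {..d}"] card_image[OF inj] by (simp only: dim_span) simp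
  moreover have "E ` {..d} \<subseteq> BM" using E_BM by auto
  ultimately show ?thesis
    using dim_eq_span[of "E ` {..d}" BM] by simp
qed

lemma E_diag: "\<lbrakk>l \<le> d; x \<in> X; y \<in> X\<rbrakk> \<Longrightarrow> E l $ x $ x = E l $ y $ y"
  using BM_const[OF E_BM, of l 0 x x y y] R_0 by auto

lemma card_X_pos: "card X > 0"
  using X_nonempty by (simp add: card_gt_0_iff)

section \<open>Entrywise polynomial structure of the scheme\<close>

text \<open>By tridiagonality, \<open>E 1 * E m\<close> is a combination of
  \<open>E 0, ..., E (m + 1)\<close> whose last coefficient is nonzero. Solving for
  \<open>E (m + 1)\<close> raises the degree by exactly one.\<close>

lemma E_degree:
  assumes "d \<ge> 1" "l \<le> d"
  shows "\<exists>f. degree f = l \<and> f \<noteq> 0 \<and> (\<forall>x\<in>X. \<forall>y\<in>X. E l $ x $ y = poly f (E 1 $ x $ y))"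
  using assms(2)
proof (induction l rule: less_induct)
  case (less l)
  obtain q where q: "\<And>l m. \<lbrakk>l \<le> d; m \<le> d\<rbrakk> \<Longrightarrow>
      E l * E m = (1 / real (card X)) *\<^sub>R (\<Sum>n\<le>d. q l m n *\<^sub>R E n)"
    and tri: "tridiagonal_nonzero d (q 1)"
    using E_Q unfolding Q_polynomial_basis_def by blast
  show ?case
  proof (cases l)
    case 0
    then show ?thesis
      using X_nonempty by (intro exI[of _ "[:1 / real (card X):]"]) (simp add: E_0)
  next
    case (Suc m)
    define c where "c = 1 / real (card X)"
    have c: "c \<noteq> 0" using card_X_pos by (simp add: c_def)
    have qz: "q 1 m n = 0" if "Suc m < n" "n \<le> d" for n
      using tri that less.prems unfolding tridiagonal_nonzero_def by auto
    have qn: "q 1 m l \<noteq> 0" using tri less.prems unfolding tridiagonal_nonzero_def Suc by auto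
    from less.IH have "\<forall>n\<in>{..m}. \<exists>f. degree f = n \<and> f \<noteq> 0 \<and> (\<forall>x\<in>X. \<forall>y\<in>X. E n $ x $ y = poly f (E 1 $ x $ y))"
      using less.prems Suc by auto
    then obtain p where p: "\<And>n. n \<le> m \<Longrightarrow> degree (p n) = n" "\<And>n. n \<le> m \<Longrightarrow> p n \<noteq> 0"
      "\<And>n x y. \<lbrakk>n \<le> m; x \<in> X; y \<in> X\<rbrakk> \<Longrightarrow> E n $ x $ y = poly (p n) (E 1 $ x $ y)"
      unfolding bchoice_iff by auto
    define g where "g = (\<Sum>n\<le>m. smult (q 1 m n) (p n))"
    \<comment> \<open>\<open>pCons 0 (p m)\<close> is \<open>p m\<close> times the variable and
      stands for the entrywise product with \<open>E 1\<close>; the factor \<open>1 / c\<close>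
      undoes the normalisation of the Krein numbers.\<close>
    define f where "f = smult (1 / q 1 m l) (smult (1 / c) (pCons 0 (p m)) - g)"
    have "degree g \<le> m" unfolding g_def
      by (rule degree_sum_le) (auto intro: order_trans[OF degree_smult_le] simp: p)
    then have "degree (- g) < degree (smult (1 / c) (pCons 0 (p m)))" using c p by simp
    then have "degree (smult (1 / c) (pCons 0 (p m)) - g) = l"
      using degree_add_eq_left[of "- g"] c p Suc by simp
    then have deg: "degree f = l" using qn by (simp add: f_def)
    have "E l $ x $ y = poly f (E 1 $ x $ y)" if "x \<in> X" "y \<in> X" for x y
    proof -
      have "E 1 * E m = c *\<^sub>R (\<Sum>n\<le>d. q 1 m n *\<^sub>R E n)"
        using q[of 1 m] assms(1) less.prems Suc by (simp add: c_def)
      also have "(\<Sum>n\<le>d. q 1 m n *\<^sub>R E n) = (\<Sum>n\<le>l. q 1 m n *\<^sub>R E n)"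
        using less.prems qz Suc by (intro sum.mono_neutral_right) auto
      also have "\<dots> = (\<Sum>n\<le>m. q 1 m n *\<^sub>R E n) + q 1 m l *\<^sub>R E l" by (simp add: Suc)
      finally have "(E 1 * E m) $ x $ y = (c *\<^sub>R ((\<Sum>n\<le>m. q 1 m n *\<^sub>R E n) + q 1 m l *\<^sub>R E l)) $ x $ y"
        by simp
      then have "E 1 $ x $ y * E m $ x $ y = c * ((\<Sum>n\<le>m. q 1 m n * E n $ x $ y) + q 1 m l * E l $ x $ y)"
        by (simp add: sum_matrix_nth)
      also have "(\<Sum>n\<le>m. q 1 m n * E n $ x $ y) = poly g (E 1 $ x $ y)"
        using that p by (simp add: g_def poly_sum)
      finally show ?thesis using c qn p(3)[of m x y] that
        by (simp add: f_def field_simps)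
    qed
    moreover have "f \<noteq> 0" using deg Suc by auto
    ultimately show ?thesis using deg by blast
  qed
qed

text \<open>The \<open>E l\<close> span the algebra, so positions on which they all agree are not
  distinguished by any of its matrices.\<close>

lemma BM_eq_of_E_eq:
  assumes "\<And>l. l \<le> d \<Longrightarrow> E l $ x $ y = E l $ x' $ y'" and "M \<in> BM"
  shows "M $ x $ y = M $ x' $ y'"
proof -
  obtain a where "M = (\<Sum>l\<le>d. a l *\<^sub>R E l)"
    using mem_span_image_finite[of "{..d}" M E] assms(2) span_E by auto
  then show ?thesis using assms(1) by (simp add: sum_matrix_nth)
qed

text \<open>
  For \<open>d = 0\<close> there is no \<open>E 1\<close>, and any matrix that is constant on \<open>X \<times> X\<close> can take its place.
\<close>

lemma polynomial_structure:
  "\<exists>T p. T \<in> BM \<and>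
    (\<forall>i\<le>d. \<forall>x\<in>X. \<forall>y\<in>X. \<forall>x'\<in>X. \<forall>y'\<in>X. T $ x $ y = T $ x' $ y' \<longrightarrow> (x, y) \<in> R i \<longrightarrow> (x', y') \<in> R i) \<and>
    (\<forall>l\<le>d. degree (p l) = l \<and> p l \<noteq> 0) \<and>
    (\<forall>l\<le>d. \<forall>x\<in>X. \<forall>y\<in>X. E l $ x $ y = poly (p l) (T $ x $ y))"
proof -
  define T where "T = (if d = 0 then 0 else E 1)"
  have T: "T \<in> BM" using E_BM by (simp add: T_def span_zero)
  have "\<exists>f. degree f = l \<and> f \<noteq> 0 \<and> (\<forall>x\<in>X. \<forall>y\<in>X. E l $ x $ y = poly f (T $ x $ y))" if "l \<le> d" for l
  proof (cases "d = 0")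
    case True
    then show ?thesis
      using X_nonempty that by (intro exI[of _ "[:1 / real (card X):]"]) (simp add: E_0)
  qed (use E_degree[of l] that in \<open>simp add: T_def\<close>)
  then have "\<forall>l\<in>{..d}. \<exists>f. degree f = l \<and> f \<noteq> 0 \<and> (\<forall>x\<in>X. \<forall>y\<in>X. E l $ x $ y = poly f (T $ x $ y))"
    by auto
  then obtain p where p: "\<And>l. l \<le> d \<Longrightarrow> degree (p l) = l \<and> p l \<noteq> 0"
    "\<And>l x y. \<lbrakk>l \<le> d; x \<in> X; y \<in> X\<rbrakk> \<Longrightarrow> E l $ x $ y = poly (p l) (T $ x $ y)"
    unfolding bchoice_iff by auto
  have "(x', y') \<in> R i"
    if "T $ x $ y = T $ x' $ y'" "x \<in> X" "y \<in> X" "x' \<in> X" "y' \<in> X" "i \<le> d" "(x, y) \<in> R i"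
    for i x y x' y'
  proof -
    \<comment> \<open>Equal values of \<open>T\<close> give equal values of every \<open>E l\<close>
      through the polynomials \<open>p l\<close>, hence equal entries of every matrix of the
      algebra, in particular of the indicator matrix of \<open>R i\<close>.\<close>
    have "adjacency (R i) $ x $ y = adjacency (R i) $ x' $ y'"
      by (rule BM_eq_of_E_eq) (use that p(2) in \<open>auto intro: span_base\<close>)
    then show ?thesis using that by (simp split: if_splits)
  qed
  then show ?thesis using T p by (intro exI[of _ T] exI[of _ p]) blast
qed

text \<open>As long as \<open>k + l \<le> d\<close>, the polynomial \<open>p k * p l\<close> has
  degree \<open>k + l\<close> and expands in \<open>p 0, ..., p (k + l)\<close>.\<close>

lemma Hadamard_degree:
  assumes "k \<le> d" "l \<le> d"
  shows "\<exists>a. E k * E l = (\<Sum>h\<le>d. a h *\<^sub>R E h) \<and> (\<forall>h. k + l < h \<longrightarrow> a h = 0)"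
proof -
  obtain T p where "T \<in> BM" and p: "\<And>l. l \<le> d \<Longrightarrow> degree (p l) = l \<and> p l \<noteq> 0"
    and E: "\<And>l x y. \<lbrakk>l \<le> d; x \<in> X; y \<in> X\<rbrakk> \<Longrightarrow> E l $ x $ y = poly (p l) (T $ x $ y)"
    using polynomial_structure by blast
  show ?thesis
  proof (cases "k + l \<le> d")
    case True
    have "degree (p k * p l) \<le> k + l" using p assms by (simp add: degree_mult_eq)
    then obtain a where a: "p k * p l = (\<Sum>j\<le>k + l. smult (a j) (p j))"
      using poly_graded_basis[of "k + l" p "p k * p l"] p True by auto
    define b where "b h = (if h \<le> k + l then a h else 0)" for h
    have "E k * E l = (\<Sum>h\<le>d. b h *\<^sub>R E h)"
    proof (intro vec_eq_iff[THEN iffD2] allI)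
      fix x y
      have "(\<Sum>h\<le>d. b h *\<^sub>R E h) $ x $ y = (\<Sum>h\<le>k + l. a h * E h $ x $ y)"
        unfolding sum_matrix_nth b_def using True by (intro sum.mono_neutral_cong_right) auto
      also have "\<dots> = (E k * E l) $ x $ y"
      proof (cases "x \<in> X \<and> y \<in> X")
        case True
        have "(\<Sum>h\<le>k + l. a h * E h $ x $ y) = poly (p k * p l) (T $ x $ y)"
          unfolding a poly_sum using True \<open>k + l \<le> d\<close> E by (intro sum.cong) auto
        then show ?thesis using True assms E by simp
      qed (use BM_outside[OF E_BM] assms True in auto)
      finally show "(E k * E l) $ x $ y = (\<Sum>h\<le>d. b h *\<^sub>R E h) $ x $ y" by simp
    qed
    then show ?thesis by (intro exI[of _ b]) (simp add: b_def)
  next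
    case False
    \<comment> \<open>When \<open>k + l\<close> exceeds \<open>d\<close>, no index up to
      \<open>d\<close> is excluded, and closure of the algebra under the entrywise product is
      enough.\<close>
    have "E k * E l \<in> BM"
    proof -
      have "\<exists>c. \<forall>(x, y)\<in>R i. (E k * E l) $ x $ y = c" if "i \<le> d" for i
      proof -
        obtain x0 y0 where "(x0, y0) \<in> R i" using R_nonempty[OF \<open>i \<le> d\<close>] by auto
        then have "(E k * E l) $ x $ y = (E k * E l) $ x0 $ y0" if "(x, y) \<in> R i" for x y
          using BM_const[OF E_BM[OF assms(1)] \<open>i \<le> d\<close> that, of x0 y0]
            BM_const[OF E_BM[OF assms(2)] \<open>i \<le> d\<close> that, of x0 y0] by simp
        then show ?thesis by blast
      qed
      then show ?thesis using BM_outside[OF E_BM] assms unfolding mem_BM by auto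
    qed
    then obtain a where "E k * E l = (\<Sum>h\<le>d. a h *\<^sub>R E h)"
      using mem_span_image_finite[of "{..d}" _ E] span_E by blast
    \<comment> \<open>The vanishing claim also covers indices above \<open>d\<close>, where
      \<open>a\<close> is arbitrary, so its values there are reset to 0.\<close>
    then have "E k * E l = (\<Sum>h\<le>d. (if h \<le> d then a h else 0) *\<^sub>R E h)" by simp
    then show ?thesis using False by (intro exI[of _ "\<lambda>h. if h \<le> d then a h else 0"]) auto
  qed
qed

text \<open>With \<open>D\<close> the projection onto \<open>C\<close> and
  \<open>M = E k ** D ** E l\<close>, cyclicity of the trace turns \<open>M \<bullet> M\<close> into
  the sum of \<open>E k * E l\<close> over \<open>C \<times> C\<close>. In the expansion of
  \<open>E k * E l\<close>, the terms with \<open>1 \<le> h \<le> t\<close> sum to zero by the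
  design property and those with \<open>h > t\<close> have coefficient zero, so only
  \<open>a 0\<close> remains.\<close>

lemma design_mult:
  assumes "is_design X d E t C" "k \<le> d" "l \<le> d" "k + l \<le> t"
  shows "E k ** adjacency (Id_on C) ** E l =
    (if k = l then (real (card C) / real (card X)) *\<^sub>R E k else 0)"
proof -
  define D where "D = adjacency (Id_on C)"
  have CX: "C \<subseteq> X" and des: "\<And>h. \<lbrakk>1 \<le> h; h \<le> d; h \<le> t\<rbrakk> \<Longrightarrow> E h *v char_vec C = 0"
    using assms(1) by (auto simp: is_design_def)
  have quad: "E h \<bullet> adjacency (C \<times> C) = 0" if "1 \<le> h" "h \<le> d" "h \<le> t" for h
  proof -
    have "(\<Sum>y\<in>C. E h $ x $ y) = 0" for x
    proof -
      have "(E h *v char_vec C) $ x = (\<Sum>y\<in>UNIV. if y \<in> C then E h $ x $ y else 0)"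
        unfolding matrix_vector_mult_def char_vec_def by (auto intro!: sum.cong)
      then have "(\<Sum>y\<in>C. E h $ x $ y) = (E h *v char_vec C) $ x"
        by (simp flip: sum.inter_filter)
      then show ?thesis using des that by simp
    qed
    then show ?thesis by (simp add: inner_adjacency_Times)
  qed
  have quad_X: "E h \<bullet> adjacency (X \<times> X) = 0" if "1 \<le> h" "h \<le> d" for h
    using E_inner[of h 0] that X_nonempty by (simp add: E_0)
  have quad_0: "E 0 \<bullet> adjacency (C' \<times> C') = (real (card C'))\<^sup>2 / real (card X)" if "C' \<subseteq> X" for C'
  proof -
    have "(\<Sum>x\<in>C'. \<Sum>y\<in>C'. E 0 $ x $ y) = (\<Sum>x\<in>C'. \<Sum>y\<in>C'. 1 / real (card X))"
      using that by (intro sum.cong) (auto simp: E_0)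
    then show ?thesis by (simp add: inner_adjacency_Times power2_eq_square)
  qed
  obtain a where a: "E k * E l = (\<Sum>h\<le>d. a h *\<^sub>R E h)" "\<And>h. k + l < h \<Longrightarrow> a h = 0"
    using Hadamard_degree[OF assms(2,3)] by blast
  \<comment> \<open>The sum over \<open>X \<times> X\<close> determines \<open>a 0\<close>: the
    all-ones matrix is a multiple of \<open>E 0\<close>, hence orthogonal to the other
    \<open>E h\<close>, and the same sum is the inner product of \<open>E k\<close> and
    \<open>E l\<close>.\<close>
  have "(E k * E l) \<bullet> adjacency (X \<times> X) = (\<Sum>h\<le>d. if h = 0 then a 0 * (E 0 \<bullet> adjacency (X \<times> X)) else 0)"
    unfolding a(1) inner_sum_left using quad_X by (intro sum.cong) auto
  then have "(E k * E l) \<bullet> adjacency (X \<times> X) = a 0 * real (card X)"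
    using quad_0[of X] card_X_pos by (simp add: power2_eq_square)
  moreover have "(E k * E l) \<bullet> adjacency (X \<times> X) = E k \<bullet> E l"
    unfolding inner_vec_def using BM_outside[OF E_BM] assms by (auto intro!: sum.cong)
  moreover have "E k \<bullet> E l = (if k = l then trace (E k) else 0)"
    using assms by (simp add: inner_matrix_trace BM_transpose E_BM E_mult trace_def)
  ultimately have a0: "a 0 * real (card X) = (if k = l then trace (E k) else 0)" by simp
  have "a h * (E h \<bullet> adjacency (C \<times> C)) = 0" if "h \<le> d" "h \<noteq> 0" for h
    using quad[of h] a(2)[of h] assms(4) that by (cases "h \<le> t") auto
  then have "(E k * E l) \<bullet> adjacency (C \<times> C) = (\<Sum>h\<le>d. if h = 0 then a 0 * (E 0 \<bullet> adjacency (C \<times> C)) else 0)"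
    unfolding a(1) inner_sum_left by (intro sum.cong) auto
  then have EC: "(E k * E l) \<bullet> adjacency (C \<times> C) = a 0 * ((real (card C))\<^sup>2 / real (card X))"
    using quad_0[OF CX] by simp
  define M where "M = E k ** D ** E l"
  have DD: "D ** D = D" by (simp add: vec_eq_iff D_def mult_Id_on_right_nth) auto
  have Dt: "transpose D = D" by (auto simp: vec_eq_iff D_def transpose_def)
  have "M \<bullet> M = trace (E k ** D ** E l ** (E l ** D ** E k))"
    using assms by (simp add: inner_matrix_trace M_def matrix_transpose_mul BM_transpose E_BM Dt matrix_mul_assoc)
  also have "\<dots> = trace (E k ** (D ** (E l ** (E l ** (D ** E k)))))"
    by (simp add: matrix_mul_assoc)
  \<comment> \<open>Moving the first \<open>E k\<close> to the end brings the two copies of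
    \<open>E k\<close> together, so that both squares reduce by idempotency.\<close>
  also have "\<dots> = trace ((D ** (E l ** (E l ** (D ** E k)))) ** E k)" by (rule trace_mul_sym)
  also have "\<dots> = trace (D ** (E l ** E l) ** (D ** (E k ** E k)))" by (simp add: matrix_mul_assoc)
  also have "\<dots> = trace (D ** E l ** (D ** E k))" using assms by (simp add: E_idem)
  also have "\<dots> = (D ** E l) \<bullet> (E k ** D)"
    using assms by (simp add: inner_matrix_trace matrix_transpose_mul BM_transpose E_BM Dt)
  also have "\<dots> = (\<Sum>x\<in>C. \<Sum>y\<in>C. E l $ x $ y * E k $ x $ y)"
  proof -
    have "(D ** E l) \<bullet> (E k ** D) = (E k * E l) \<bullet> adjacency (C \<times> C)"
      unfolding inner_vec_def D_def by (auto simp: mult_Id_on_right_nth mult_Id_on_left_nth intro!: sum.cong)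
    then show ?thesis by (simp add: inner_adjacency_Times mult.commute)
  qed
  finally have MM: "M \<bullet> M = a 0 * ((real (card C))\<^sup>2 / real (card X))"
    using EC by (simp add: inner_adjacency_Times mult.commute)
  show ?thesis
  proof (cases "k = l")
    case False
    then have "M \<bullet> M = 0" using a0 MM card_X_pos by simp
    then show ?thesis using False by (simp add: M_def D_def)
  next
    case True
    obtain x0 where x0: "x0 \<in> X" using X_nonempty by blast
    \<comment> \<open>The diagonal of \<open>E k\<close> is constant on \<open>X\<close>, so its sum
      over \<open>C\<close> is the trace scaled by \<open>card C / card X\<close>.\<close>
    have diag: "E k $ x $ x = E k $ x0 $ x0" if "x \<in> X" for x
      using E_diag x0 assms that by blast
    have tr: "trace (E k) = real (card X) * E k $ x0 $ x0"
    proof -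
      have "trace (E k) = (\<Sum>x\<in>UNIV. if x \<in> X then E k $ x0 $ x0 else 0)"
        unfolding trace_def using BM_outside[OF E_BM] diag assms by (intro sum.cong refl) (metis (full_types))
      then show ?thesis by (simp flip: sum.inter_filter)
    qed
    have trC: "trace (E k ** D) = real (card C) * E k $ x0 $ x0"
    proof -
      have "trace (E k ** D) = (\<Sum>x\<in>UNIV. if x \<in> C then E k $ x0 $ x0 else 0)"
        unfolding trace_def D_def mult_Id_on_right_nth using diag CX by (intro sum.cong refl) (metis subsetD)
      then show ?thesis by (simp flip: sum.inter_filter)
    qed
    have "M \<bullet> E k = trace (E k ** D ** (E k ** E k))"
      using True assms by (simp add: M_def inner_matrix_trace BM_transpose E_BM matrix_mul_assoc)
    also have "\<dots> = trace (E k ** (E k ** D))" using assms by (simp only: E_idem) (rule trace_mul_sym)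
    also have "\<dots> = trace (E k ** D)" using assms by (simp add: E_idem matrix_mul_assoc)
    finally have ME: "M \<bullet> E k = real (card C) * E k $ x0 $ x0" using trC by simp
    have EE: "E k \<bullet> E k = real (card X) * E k $ x0 $ x0"
      using assms tr by (simp add: inner_matrix_trace BM_transpose E_BM E_idem)
    have MM': "M \<bullet> M = (real (card C))\<^sup>2 * E k $ x0 $ x0 / real (card X)"
      using MM a0 True tr card_X_pos by simp
    define c where "c = real (card C) / real (card X)"
    \<comment> \<open>With \<open>e\<close> the constant diagonal entry, the three terms are 1, -2
      and 1 times \<open>card C * card C * e / card X\<close>.\<close>
    have "(M - c *\<^sub>R E k) \<bullet> (M - c *\<^sub>R E k) = M \<bullet> M - 2 * c * (M \<bullet> E k) + c\<^sup>2 * (E k \<bullet> E k)"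
      by (simp add: inner_diff_left inner_diff_right inner_commute power2_eq_square algebra_simps)
    also have "\<dots> = 0"
      unfolding MM' ME EE c_def using card_X_pos by (simp add: field_simps power2_eq_square)
    finally show ?thesis using True by (simp add: M_def D_def c_def)
  qed
qed

end

section \<open>Families of designs\<close>

text \<open>The designs form a set rather than a sequence, in line with fibers that serve as their
  own indices. The parameters \<open>T\<close> and \<open>p\<close> are instances of the data from
  \<open>polynomial_structure\<close>, fixed here so that all later statements share them.\<close>

locale design_family = Q_scheme +
  fixes \<F> :: "'a set set" and \<tau> :: "'a set \<Rightarrow> nat"
    and T :: "real^'a^'a" and p :: "nat \<Rightarrow> real poly"
  assumes design: "Z \<in> \<F> \<Longrightarrow> is_design X d E (\<tau> Z) Z"
    and disj: "\<lbrakk>Z \<in> \<F>; W \<in> \<F>; Z \<noteq> W\<rbrakk> \<Longrightarrow> Z \<inter> W = {}"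
    and bound: "\<lbrakk>Z \<in> \<F>; W \<in> \<F>; V \<in> \<F>\<rbrakk> \<Longrightarrow>
      card (rel_indices d R Z W) + card (rel_indices d R W V) \<le> \<tau> W + 2"
    and T_BM: "T \<in> BM"
    and T_sep: "\<lbrakk>i \<le> d; x \<in> X; y \<in> X; x' \<in> X; y' \<in> X; T $ x $ y = T $ x' $ y'; (x, y) \<in> R i\<rbrakk>
      \<Longrightarrow> (x', y') \<in> R i"
    and p_degree: "l \<le> d \<Longrightarrow> degree (p l) = l"
    and p_nz: "l \<le> d \<Longrightarrow> p l \<noteq> 0"
    and E_poly: "\<lbrakk>l \<le> d; x \<in> X; y \<in> X\<rbrakk> \<Longrightarrow> E l $ x $ y = poly (p l) (T $ x $ y)"
begin

definition s :: "'a set \<Rightarrow> 'a set \<Rightarrow> nat" where "s Z W = card (rel_indices d R Z W)"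

text \<open>Unlike \<open>rel_indices\<close> this admits the index 0, so \<open>N\<close> counts
  all relations of a block, including the diagonal one.\<close>

definition \<Lambda> :: "'a set \<Rightarrow> 'a set \<Rightarrow> nat set" where "\<Lambda> Z W = {i. i \<le> d \<and> R i \<inter> (Z \<times> W) \<noteq> {}}"

definition N :: "'a set \<Rightarrow> 'a set \<Rightarrow> nat" where "N Z W = card (\<Lambda> Z W)"

definition block :: "'a set \<Rightarrow> 'a set \<Rightarrow> ('a \<times> 'a) set set" where
  "block Z W = (\<lambda>i. R i \<inter> (Z \<times> W)) ` \<Lambda> Z W"

text \<open>For designs, \<open>\<gamma> Z W * \<gamma> W V * (card W / card X) = \<gamma> Z
  V\<close>, which absorbs the constant of \<open>design_mult\<close> and makes products of
  \<open>G\<close> come out without a factor.\<close>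

definition \<gamma> :: "'a set \<Rightarrow> 'a set \<Rightarrow> real" where
  "\<gamma> Z W = real (card X) / sqrt (real (card Z) * real (card W))"

definition G :: "'a set \<Rightarrow> 'a set \<Rightarrow> nat \<Rightarrow> real^'a^'a" where
  "G Z W l = \<gamma> Z W *\<^sub>R (adjacency (Id_on Z) ** E l ** adjacency (Id_on W))"

definition Pol :: "'a set \<Rightarrow> 'a set \<Rightarrow> real poly \<Rightarrow> real^'a^'a" where
  "Pol Z W f = (\<chi> x y. if x \<in> Z \<and> y \<in> W then poly f (T $ x $ y) else 0)"

definition L :: "'a set \<Rightarrow> real^'a^'a" where
  "L Z = adjacency (Id_on Z) - (\<Sum>l<s Z Z. G Z Z l)"

text \<open>
  The products \<open>G Z Z (s Z Z) ** G Z W m\<close> are not controlled by the design strengths, so the last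
  idempotent of a diagonal block is defined as the complement of the others.
\<close>

definition F :: "'a set \<Rightarrow> 'a set \<Rightarrow> nat \<Rightarrow> real^'a^'a" where
  "F Z W l = (if Z = W \<and> s Z Z \<le> l then L Z else G Z W l)"

section \<open>Counting the relations of a block\<close>

lemma FF_subset: "Z \<in> \<F> \<Longrightarrow> Z \<subseteq> X" and FF_nonempty: "Z \<in> \<F> \<Longrightarrow> Z \<noteq> {}"
  using design by (auto simp: is_design_def)

lemma card_FF_pos: "Z \<in> \<F> \<Longrightarrow> card Z > 0"
  using FF_nonempty by (simp add: card_gt_0_iff)

lemma s_commute: "s Z W = s W Z"
proof -
  have "rel_indices d R Z W \<subseteq> rel_indices d R W Z" for Z W
    unfolding rel_indices_def using R_sym by (auto dest: symD)
  then have "rel_indices d R Z W = rel_indices d R W Z" by blast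
  then show ?thesis by (simp add: s_def)
qed

lemma s_bound: "\<lbrakk>Z \<in> \<F>; W \<in> \<F>; V \<in> \<F>; l < s Z W; m < s W V\<rbrakk> \<Longrightarrow> l + m \<le> \<tau> W"
  using bound[of Z W V] by (simp add: s_def)

lemma finite_\<Lambda>: "finite (\<Lambda> Z W)"
  by (simp add: \<Lambda>_def)

text \<open>The diagonal relation makes a diagonal block one dimension larger than
  \<open>s Z Z\<close>; \<open>L\<close> fills this extra dimension.\<close>

lemma N_diag: assumes "Z \<in> \<F>" shows "N Z Z = Suc (s Z Z)"
proof -
  have "\<Lambda> Z Z = insert 0 (rel_indices d R Z Z)"
  proof -
    have "R 0 \<inter> (Z \<times> Z) \<noteq> {}" using FF_nonempty[OF assms] FF_subset[OF assms] R_0 by auto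
    then show ?thesis by (auto simp: \<Lambda>_def rel_indices_def)
  qed
  then show ?thesis by (simp add: N_def s_def rel_indices_def)
qed

lemma N_offdiag: assumes "Z \<in> \<F>" "W \<in> \<F>" "Z \<noteq> W" shows "N Z W = s Z W"
proof -
  have "R 0 \<inter> (Z \<times> W) = {}" using disj[OF assms] R_0 by auto
  then have "1 \<le> i" if "R i \<inter> (Z \<times> W) \<noteq> {}" for i using that by (cases i) auto
  then have "\<Lambda> Z W = rel_indices d R Z W" unfolding \<Lambda>_def rel_indices_def atLeastAtMost_iff by blast
  then show ?thesis by (simp add: N_def s_def)
qed

lemma N_eq: "\<lbrakk>Z \<in> \<F>; W \<in> \<F>\<rbrakk> \<Longrightarrow> N Z W = (if Z = W then Suc (s Z Z) else s Z W)"
  by (simp add: N_diag N_offdiag)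

lemma s_le_N: "\<lbrakk>Z \<in> \<F>; W \<in> \<F>\<rbrakk> \<Longrightarrow> s Z W \<le> N Z W"
  by (auto simp: N_eq)

lemma N_le: "N Z W \<le> Suc d"
  using card_mono[of "{..d}" "\<Lambda> Z W"] by (auto simp: N_def \<Lambda>_def)

lemma s_le: "s Z W \<le> d"
proof -
  have "rel_indices d R Z W \<subseteq> {1..d}" unfolding rel_indices_def by blast
  then show ?thesis using card_mono[of "{1..d}" "rel_indices d R Z W"] by (simp add: s_def)
qed

lemma N_pos: assumes "Z \<in> \<F>" "W \<in> \<F>" shows "N Z W > 0"
proof -
  obtain x y where xy: "x \<in> Z" "y \<in> W" using FF_nonempty assms by blast
  then obtain i where "i \<le> d" "(x, y) \<in> R i" using R_ex FF_subset assms by blast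
  then have "i \<in> \<Lambda> Z W" using xy by (auto simp: \<Lambda>_def)
  then show ?thesis using finite_\<Lambda> by (auto simp: N_def card_gt_0_iff)
qed

lemma block_disjoint: "disjoint (block Z W)"
proof (rule disjointI)
  fix A B assume "A \<in> block Z W" "B \<in> block Z W" "A \<noteq> B"
  then obtain i j where "i \<le> d" "j \<le> d" "i \<noteq> j" "A = R i \<inter> (Z \<times> W)" "B = R j \<inter> (Z \<times> W)"
    by (auto simp: block_def \<Lambda>_def)
  then show "A \<inter> B = {}" using R_disjoint[of i j] by blast
qed

lemma block_nonempty: "{} \<notin> block Z W"
  by (auto simp: block_def \<Lambda>_def)

lemma inj_on_block: "inj_on (\<lambda>i. R i \<inter> (Z \<times> W)) (\<Lambda> Z W)"
proof (rule inj_onI, rule ccontr)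
  fix i j assume "i \<in> \<Lambda> Z W" "j \<in> \<Lambda> Z W" "R i \<inter> (Z \<times> W) = R j \<inter> (Z \<times> W)" "i \<noteq> j"
  then show False using R_disjoint[of i j] by (auto simp: \<Lambda>_def)
qed

lemma card_block: "card (block Z W) = N Z W"
  using inj_on_block by (simp add: block_def N_def card_image)

lemma Union_block:
  assumes "Z \<subseteq> X" "W \<subseteq> X"
  shows "\<Union> (block Z W) = Z \<times> W"
proof
  show "Z \<times> W \<subseteq> \<Union> (block Z W)"
  proof
    fix u assume u: "u \<in> Z \<times> W"
    then obtain i where "i \<le> d" "u \<in> R i" using R_ex assms by (cases u) blast
    then show "u \<in> \<Union> (block Z W)" using u by (auto simp: block_def \<Lambda>_def)
  qed
qed (auto simp: block_def)

lemma mem_span_block: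
  assumes "Z \<subseteq> X" "W \<subseteq> X"
  shows "M \<in> span (adjacency ` block Z W) \<longleftrightarrow>
    (\<forall>i\<le>d. \<exists>c. \<forall>(x, y)\<in>R i \<inter> (Z \<times> W). M $ x $ y = c) \<and>
    (\<forall>x y. (x, y) \<notin> Z \<times> W \<longrightarrow> M $ x $ y = 0)"
proof -
  have "(\<forall>A\<in>block Z W. \<exists>c. \<forall>(x, y)\<in>A. M $ x $ y = c) \<longleftrightarrow>
    (\<forall>i\<le>d. \<exists>c. \<forall>(x, y)\<in>R i \<inter> (Z \<times> W). M $ x $ y = c)"
    by (auto simp: block_def \<Lambda>_def)
  then show ?thesis
    unfolding mem_span_adjacency[OF block_disjoint] Union_block[OF assms] by simp
qed

lemma dim_block: "dim (span (adjacency ` block Z W)) = N Z W"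
  using dim_span_adjacency[OF block_disjoint block_nonempty] by (simp add: card_block)

section \<open>Polynomials in \<open>T\<close> on a block\<close>

lemma Pol_nth: "Pol Z W f $ x $ y = (if x \<in> Z \<and> y \<in> W then poly f (T $ x $ y) else 0)"
  by (simp add: Pol_def)

lemma G_nth: "G Z W l $ x $ y = (if x \<in> Z \<and> y \<in> W then \<gamma> Z W * E l $ x $ y else 0)"
  by (simp add: G_def mult_Id_on_left_nth mult_Id_on_right_nth)

lemma G_Pol: "\<lbrakk>Z \<subseteq> X; W \<subseteq> X; l \<le> d\<rbrakk> \<Longrightarrow> G Z W l = Pol Z W (smult (\<gamma> Z W) (p l))"
  by (auto simp: vec_eq_iff G_nth Pol_nth E_poly subset_iff)

lemma Pol_add: "Pol Z W (f + g) = Pol Z W f + Pol Z W g"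
  and Pol_smult: "Pol Z W (smult a f) = a *\<^sub>R Pol Z W f"
  and Pol_mult: "Pol Z W (f * g) = Pol Z W f * Pol Z W g"
  and Pol_0: "Pol Z W 0 = 0"
  by (auto simp: vec_eq_iff Pol_nth)

lemma Pol_sum: "Pol Z W (\<Sum>i\<in>I. f i) = (\<Sum>i\<in>I. Pol Z W (f i))"
  by (induction I rule: infinite_finite_induct) (auto simp: Pol_add Pol_0)

lemma Pol_in_block: assumes "Z \<subseteq> X" "W \<subseteq> X" shows "Pol Z W f \<in> span (adjacency ` block Z W)"
proof -
  have "\<exists>c. \<forall>(x, y)\<in>R i \<inter> (Z \<times> W). Pol Z W f $ x $ y = c" if i: "i \<le> d" for i
  proof -
    obtain x0 y0 where 0: "(x0, y0) \<in> R i" using R_nonempty[OF \<open>i \<le> d\<close>] by auto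
    have "T $ x $ y = T $ x0 $ y0" if "(x, y) \<in> R i" for x y
      using BM_const[OF T_BM i that 0] .
    then have "\<forall>(x, y)\<in>R i \<inter> (Z \<times> W). Pol Z W f $ x $ y = poly f (T $ x0 $ y0)"
      by (auto simp: Pol_nth)
    then show ?thesis by blast
  qed
  then show ?thesis unfolding mem_span_block[OF assms] by (auto simp: Pol_nth)
qed

lemma G_in_block: "\<lbrakk>Z \<in> \<F>; W \<in> \<F>; l \<le> d\<rbrakk> \<Longrightarrow> G Z W l \<in> span (adjacency ` block Z W)"
  using Pol_in_block[of Z W] by (simp add: G_Pol FF_subset)

text \<open>Distinct relations of the block have distinct values of \<open>T\<close>, and each of
  these \<open>N Z W\<close> values is a root of \<open>f\<close>.\<close>

lemma Pol_eq_0: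
  assumes Z: "Z \<subseteq> X" and W: "W \<subseteq> X" and f: "Pol Z W f = 0" "degree f < N Z W"
  shows "f = 0"
proof (rule ccontr)
  assume "f \<noteq> 0"
  have "\<forall>i\<in>\<Lambda> Z W. \<exists>u. u \<in> R i \<inter> (Z \<times> W)" by (auto simp: \<Lambda>_def)
  then obtain u where u: "\<And>i. i \<in> \<Lambda> Z W \<Longrightarrow> u i \<in> R i \<inter> (Z \<times> W)" unfolding bchoice_iff by auto
  define v where "v i = T $ fst (u i) $ snd (u i)" for i
  have "inj_on v (\<Lambda> Z W)"
  proof (rule inj_onI, rule ccontr)
    fix i j assume ij: "i \<in> \<Lambda> Z W" "j \<in> \<Lambda> Z W" "v i = v j" "i \<noteq> j"
    obtain x y x' y' where xy: "u i = (x, y)" "u j = (x', y')" by fastforce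
    have "(x, y) \<in> R i \<inter> (Z \<times> W)" "(x', y') \<in> R j \<inter> (Z \<times> W)"
      using u[OF ij(1)] u[OF ij(2)] xy by auto
    moreover from this have "(x', y') \<in> R i"
      using T_sep[of i x y x' y'] ij(1,3) xy Z W by (auto simp: v_def \<Lambda>_def)
    moreover have "R i \<inter> R j = {}" using R_disjoint ij by (auto simp: \<Lambda>_def)
    ultimately show False by blast
  qed
  moreover have "v ` \<Lambda> Z W \<subseteq> {x. poly f x = 0}"
  proof
    fix a assume "a \<in> v ` \<Lambda> Z W"
    then obtain i where i: "i \<in> \<Lambda> Z W" "a = v i" by blast
    have "Pol Z W f $ fst (u i) $ snd (u i) = 0" using f by simp
    then show "a \<in> {x. poly f x = 0}" using u[OF i(1)] i(2) by (auto simp: Pol_nth v_def)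
  qed
  ultimately have "N Z W \<le> card {x. poly f x = 0}"
    using card_mono[OF poly_roots_finite[OF \<open>f \<noteq> 0\<close>], of "v ` \<Lambda> Z W"] by (simp add: N_def card_image)
  also have "\<dots> \<le> degree f" using \<open>f \<noteq> 0\<close> by (rule card_poly_roots_bound)
  finally show False using f(2) by simp
qed

lemma \<gamma>_pos: "\<lbrakk>Z \<in> \<F>; W \<in> \<F>\<rbrakk> \<Longrightarrow> \<gamma> Z W > 0"
  by (simp add: \<gamma>_def card_X_pos card_FF_pos)

lemma G_nz: assumes "Z \<in> \<F>" "W \<in> \<F>" "l < N Z W" shows "G Z W l \<noteq> 0"
proof
  assume "G Z W l = 0"
  moreover have l: "l \<le> d" using assms N_le[of Z W] by simp
  ultimately have "smult (\<gamma> Z W) (p l) = 0"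
    using assms p_degree by (intro Pol_eq_0[of Z W]) (auto simp: G_Pol FF_subset)
  then show False using \<gamma>_pos[OF assms(1,2)] p_nz[OF l] by simp
qed

text \<open>A vanishing combination of the \<open>G Z W l\<close> is a polynomial in
  \<open>T\<close> of degree below \<open>N Z W\<close>, hence the zero polynomial. The
  \<open>p l\<close> have distinct degrees, so all coefficients vanish, and the dimensions
  agree.\<close>

lemma G_basis:
  assumes "Z \<in> \<F>" "W \<in> \<F>"
  shows "span (G Z W ` {..<N Z W}) = span (adjacency ` block Z W)"
proof -
  have l: "l \<le> d" if "l < N Z W" for l using that N_le[of Z W] by simp
  have "\<forall>l\<in>{..<N Z W}. a l = 0" if "(\<Sum>l<N Z W. a l *\<^sub>R G Z W l) = 0" for a
  proof -
    define k where "k = N Z W - 1"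
    have k: "{..<N Z W} = {..k}" "k \<le> d"
      using N_pos[OF assms] l[of k] by (auto simp: k_def)
    define f where "f = (\<Sum>l\<le>k. smult (a l * \<gamma> Z W) (p l))"
    have deg: "degree f \<le> k" unfolding f_def
      using k by (intro degree_sum_le) (auto intro: order_trans[OF degree_smult_le] simp: p_degree)
    have "Pol Z W f = (\<Sum>l<N Z W. a l *\<^sub>R G Z W l)"
      unfolding f_def Pol_sum k(1) using k(2) assms
      by (intro sum.cong) (auto simp: G_Pol FF_subset Pol_smult)
    then have "f = 0"
      using that deg N_pos[OF assms] assms by (intro Pol_eq_0[of Z W]) (auto simp: FF_subset k_def)
    have "a l = 0" if "l \<le> k" for l
      using that
    \<comment> \<open>Descending induction on the index: in the coefficient of degree
      \<open>l\<close>, the higher indices are already gone and the lower ones have too small a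
      degree.\<close>
    proof (induction "k - l" arbitrary: l rule: less_induct)
      case less
      have "coeff (\<Sum>j\<le>k. smult (a j * \<gamma> Z W) (p j)) l = (\<Sum>j\<le>k. if j = l then a l * \<gamma> Z W * coeff (p l) l else 0)"
        unfolding coeff_sum
      proof (rule sum.cong)
        fix j assume j: "j \<in> {..k}"
        show "coeff (smult (a j * \<gamma> Z W) (p j)) l = (if j = l then a l * \<gamma> Z W * coeff (p l) l else 0)"
        proof (cases "j < l")
          case True
          then have "coeff (p j) l = 0" using j k p_degree by (intro coeff_eq_0) auto
          then show ?thesis using True by simp
        next
          case False
          then show ?thesis using less.hyps[of j] j by (cases "j = l") auto
        qed
      qed simp
      then have "a l * \<gamma> Z W * coeff (p l) l = 0"
        using \<open>f = 0\<close> less.prems by (simp add: f_def)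
      moreover have "coeff (p l) l \<noteq> 0"
        using p_degree[of l] p_nz[of l] k less.prems by (metis le_trans leading_coeff_0_iff)
      ultimately show ?case using \<gamma>_pos[OF assms] by simp
    qed
    then show ?thesis using k by auto
  qed
  note ind = independent_family[of "{..<N Z W}" "G Z W", OF finite_lessThan this]
  have "dim (span (G Z W ` {..<N Z W})) = N Z W"
    using dim_eq_card_independent[OF ind(2)] card_image[OF ind(1)] by simp
  moreover have "G Z W ` {..<N Z W} \<subseteq> span (adjacency ` block Z W)"
    using G_in_block assms l by auto
  ultimately show ?thesis
    using dim_eq_span[of "G Z W ` {..<N Z W}" "span (adjacency ` block Z W)"] dim_block[of Z W] by simp
qed

lemma block_coefficients:
  assumes "Z \<in> \<F>" "W \<in> \<F>" "M \<in> span (adjacency ` block Z W)"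
  obtains a where "M = (\<Sum>l<N Z W. a l *\<^sub>R G Z W l)"
  using mem_span_image_finite[of "{..<N Z W}" M "G Z W"] G_basis[OF assms(1,2)] assms(3) by auto

section \<open>Products of \<open>G\<close> and the complementary idempotent
  \<open>L\<close>\<close>

text \<open>The two inner projections onto \<open>W\<close> merge into one, and
  \<open>design_mult\<close> applies to the middle. The condition bounds \<open>l + m\<close>
  directly because later uses include products such as \<open>G Z Z (s Z Z) ** G Z W m\<close>,
  where an index is not below the respective \<open>s\<close>.\<close>

lemma G_mult:
  assumes "Z \<in> \<F>" "W \<in> \<F>" "V \<in> \<F>" "l \<le> d" "m \<le> d" "l + m \<le> \<tau> W"
  shows "G Z W l ** G W V m = (if l = m then G Z V l else 0)"
proof -
  define D where "D Z = adjacency (Id_on Z)" for Z :: "'a set"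
  have DD: "D W ** D W = D W" by (simp add: vec_eq_iff D_def mult_Id_on_right_nth) auto
  have "G Z W l ** G W V m =
    (\<gamma> Z W * \<gamma> W V) *\<^sub>R (D Z ** E l ** D W ** (D W ** E m ** D V))"
    by (simp add: G_def D_def matrix_mult_scaleR_left matrix_mult_scaleR_right)
  also have "D Z ** E l ** D W ** (D W ** E m ** D V) = D Z ** (E l ** (D W ** D W) ** E m) ** D V"
    by (simp add: matrix_mul_assoc)
  also have "\<dots> = D Z ** (if l = m then (real (card W) / real (card X)) *\<^sub>R E l else 0) ** D V"
    using design_mult[OF design[OF assms(2)] assms(4-6)] by (simp only: DD) (simp add: D_def)
  finally have *: "G Z W l ** G W V m = (\<gamma> Z W * \<gamma> W V) *\<^sub>R
    (D Z ** (if l = m then (real (card W) / real (card X)) *\<^sub>R E l else 0) ** D V)" .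
  have "\<gamma> Z W * \<gamma> W V * (real (card W) / real (card X)) = \<gamma> Z V"
    using FF_nonempty[OF assms(1)] FF_nonempty[OF assms(2)] FF_nonempty[OF assms(3)]
    unfolding \<gamma>_def real_sqrt_mult
    by (simp add: field_simps)
  then show ?thesis
    by (simp add: * matrix_mult_scaleR_left matrix_mult_scaleR_right)
      (simp add: G_def D_def mult.assoc)
qed

lemma G_mult_s:
  "\<lbrakk>Z \<in> \<F>; W \<in> \<F>; V \<in> \<F>; l < s Z W; m < s W V\<rbrakk> \<Longrightarrow>
    G Z W l ** G W V m = (if l = m then G Z V l else 0)"
  using s_bound s_le[of Z W] s_le[of W V] by (intro G_mult) auto

lemma G_transpose: "l \<le> d \<Longrightarrow> transpose (G Z W l) = G W Z l"
  by (auto simp: vec_eq_iff transpose_def G_nth \<gamma>_def mult.commute BM_sym[OF E_BM])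

lemma L_transpose: "transpose (L Z) = L Z"
proof -
  have "L Z $ y $ x = L Z $ x $ y" for x y
    using G_transpose[of _ Z Z] s_le[of Z Z]
    by (auto simp: L_def sum_matrix_nth vec_eq_iff transpose_def intro!: sum.cong)
  then show ?thesis by (simp add: vec_eq_iff transpose_def)
qed

text \<open>Among the units \<open>G Z Z l\<close> subtracted in \<open>L Z\<close>, only the one
  with \<open>l = m\<close> acts on \<open>G Z W m\<close>, and it acts as the identity.\<close>

lemma L_mult_G:
  assumes "Z \<in> \<F>" "W \<in> \<F>" "m < s Z W"
  shows "L Z ** G Z W m = (if s Z Z \<le> m then G Z W m else 0)"
proof -
  have "adjacency (Id_on Z) ** G Z W m = G Z W m"
    by (auto simp: vec_eq_iff mult_Id_on_left_nth G_nth)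
  then have "L Z ** G Z W m = G Z W m - (\<Sum>l<s Z Z. G Z Z l ** G Z W m)"
    by (simp add: L_def matrix_mult_diff_left matrix_mult_sum_left)
  also have "(\<Sum>l<s Z Z. G Z Z l ** G Z W m) = (\<Sum>l<s Z Z. if l = m then G Z W m else 0)"
    using assms by (intro sum.cong) (auto simp: G_mult_s)
  finally show ?thesis by simp
qed

lemma L_idem: assumes "Z \<in> \<F>" shows "L Z ** L Z = L Z"
proof -
  have "L Z ** adjacency (Id_on Z) = L Z"
    by (auto simp: vec_eq_iff mult_Id_on_right_nth L_def sum_matrix_nth G_nth)
  moreover have "L Z ** (\<Sum>l<s Z Z. G Z Z l) = 0"
    using assms by (auto simp: matrix_mult_sum_right L_mult_G intro!: sum.neutral)
  ultimately show ?thesis by (subst (2) L_def) (simp add: matrix_mult_diff_right)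
qed

text \<open>Otherwise the identity on \<open>Z\<close> would be a polynomial \<open>f\<close> in
  \<open>T\<close>, zero or of degree below \<open>s Z Z\<close>. Multiplying it by the linear
  factor that vanishes at the constant diagonal value of \<open>T\<close> gives a polynomial that is
  zero on the whole block and has degree below \<open>N Z Z\<close>, so it is zero, and then so is
  \<open>f\<close>.\<close>

lemma L_nz: assumes Z: "Z \<in> \<F>" shows "L Z \<noteq> 0"
proof
  assume "L Z = 0"
  then have L: "adjacency (Id_on Z) = (\<Sum>l<s Z Z. G Z Z l)" by (simp add: L_def)
  define f where "f = (\<Sum>l<s Z Z. smult (\<gamma> Z Z) (p l))"
  have f: "Pol Z Z f = adjacency (Id_on Z)"
    unfolding L f_def Pol_sum using s_le[of Z Z] FF_subset[OF Z] by (intro sum.cong) (auto simp: G_Pol)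
  obtain x0 where x0: "x0 \<in> Z" using FF_nonempty[OF Z] by blast
  define g where "g = f * [:- (T $ x0 $ x0), 1:]"
  have "T $ x $ x = T $ x0 $ x0" if "x \<in> Z" for x
    using BM_const[OF T_BM, of 0 x x x0 x0] that x0 FF_subset[OF Z] unfolding R_0 by (auto simp: Id_on_iff)
  then have "Pol Z Z g = 0"
    using f by (auto simp: vec_eq_iff Pol_nth g_def split: if_splits)
  moreover have "degree g < N Z Z"
  proof (cases "s Z Z")
    case 0
    then show ?thesis using Z by (simp add: g_def f_def N_diag)
  next
    case (Suc k)
    have "degree f \<le> k" unfolding f_def Suc lessThan_Suc_atMost
      using Suc s_le[of Z Z]
      by (intro degree_sum_le) (auto intro: order_trans[OF degree_smult_le] simp: p_degree)
    then show ?thesis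
      using degree_mult_le[of f "[:- (T $ x0 $ x0), 1:]"] Z Suc by (simp add: g_def N_diag)
  qed
  ultimately have "g = 0" using FF_subset[OF Z] by (intro Pol_eq_0) auto
  then have "f = 0" unfolding g_def mult_eq_0_iff by simp
  then have "adjacency (Id_on Z) $ x0 $ x0 = 0" using f Pol_0[of Z Z] by (metis zero_index)
  then show False using x0 by (simp add: Id_on_iff)
qed

lemma Id_in_block: assumes "Z \<in> \<F>" shows "Id_on Z \<in> block Z Z"
proof -
  have "Id_on Z = R 0 \<inter> (Z \<times> Z)" using FF_subset[OF assms] R_0 by auto
  moreover have "R 0 \<inter> (Z \<times> Z) \<noteq> {}" using FF_subset[OF assms] FF_nonempty[OF assms] R_0 by auto
  ultimately show ?thesis by (auto simp: block_def \<Lambda>_def)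
qed

lemma L_in_block: assumes "Z \<in> \<F>" shows "L Z \<in> span (adjacency ` block Z Z)"
  unfolding L_def using assms s_le[of Z Z] Id_in_block[OF assms]
  by (intro span_diff span_sum G_in_block) (auto intro: span_base)

section \<open>Inequalities between the numbers \<open>s\<close>\<close>

text \<open>If the claim fails for \<open>l\<close>, it fails for \<open>k = s Z V\<close>. The
  block of \<open>Z\<close> and \<open>V\<close> has dimension \<open>k\<close>, so
  \<open>G Z V k\<close> is a combination of the lower \<open>G Z V j\<close>, and
  \<open>G W Z k\<close> annihilates it. Computed through \<open>W\<close>, the same product is
  \<open>G W V k\<close>, which is nonzero.\<close>

lemma s_triangle:
  assumes "Z \<in> \<F>" "W \<in> \<F>" "V \<in> \<F>" "Z \<noteq> V" "l < s Z W" "l < s W V"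
  shows "l < s Z V"
proof (rule ccontr)
  assume "\<not> l < s Z V"
  define k where "k = s Z V"
  have k: "k < s Z W" "k < s W V" "k < s W Z" using \<open>\<not> l < s Z V\<close> assms s_commute[of W Z] by (auto simp: k_def)
  then have kd: "k \<le> d" using s_le[of Z W] by simp
  have "W \<noteq> V" using k by (auto simp: k_def)
  have prod: "G Z W k ** G W V k = G Z V k" using assms k by (simp add: G_mult_s)
  obtain a where a: "G Z V k = (\<Sum>j<s Z V. a j *\<^sub>R G Z V j)"
    using block_coefficients[OF assms(1,3) G_in_block[OF assms(1,3) kd]] N_offdiag assms by metis
  have "G W Z k ** G Z V k = 0"
    unfolding a using assms k
    by (auto simp: matrix_mult_sum_right matrix_mult_scaleR_right G_mult_s k_def intro!: sum.neutral)
  moreover have "G W Z k ** G Z V k = G W W k ** G W V k"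
  proof -
    have "G W Z k ** G Z W k = G W W k" using assms k by (simp add: G_mult_s)
    then show ?thesis unfolding prod[symmetric] by (simp add: matrix_mul_assoc)
  qed
  \<comment> \<open>Since \<open>k\<close> may fail to lie below \<open>s W W\<close>, the bound on
    \<open>k + k\<close> comes from the pairs \<open>Z\<close>, \<open>W\<close> and
    \<open>W\<close>, \<open>V\<close>.\<close>
  moreover have "G W W k ** G W V k = G W V k"
    using s_bound[OF assms(1-3) k(1,2)] kd assms by (simp add: G_mult)
  ultimately have "G W V k = 0" by simp
  then show False using G_nz[OF assms(2,3), of k] N_offdiag[OF assms(2,3) \<open>W \<noteq> V\<close>] k by simp
qed

text \<open>Here the index \<open>l = s Z Z\<close> is itself covered by the strength of
  \<open>Z\<close>, so \<open>L Z\<close> fixes \<open>G Z Z l\<close> while it kills the lower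
  \<open>G Z Z k\<close>. The expansion of \<open>L Z\<close> in this basis thus reduces to a
  multiple of \<open>G Z Z l\<close>, and two nonzero idempotents that are proportional
  coincide.\<close>

lemma L_eq_G:
  assumes "Z \<in> \<F>" "W \<in> \<F>" "s Z Z < s Z W"
  shows "L Z = G Z Z (s Z Z)"
proof -
  define l where "l = s Z Z"
  have l: "l < s Z W" "l < s W Z" using assms s_commute[of W Z] by (auto simp: l_def)
  then have "2 * l \<le> \<tau> Z" "l \<le> d" using s_bound[OF assms(2,1,2) l(2,1)] s_le[of Z W] by auto
  then have G: "G Z Z k ** G Z Z l = (if k = l then G Z Z l else 0)" if "k \<le> l" for k
    using that assms by (simp add: G_mult)
  have "adjacency (Id_on Z) ** G Z Z l = G Z Z l"
    by (auto simp: vec_eq_iff mult_Id_on_left_nth G_nth)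
  then have LG: "L Z ** G Z Z l = G Z Z l"
    using G by (simp add: L_def matrix_mult_diff_left matrix_mult_sum_left l_def)
  obtain a where "L Z = (\<Sum>k<N Z Z. a k *\<^sub>R G Z Z k)"
    using block_coefficients[OF assms(1,1) L_in_block[OF assms(1)]] by blast
  then have a: "L Z = (\<Sum>k<l. a k *\<^sub>R G Z Z k) + a l *\<^sub>R G Z Z l"
    using assms by (simp add: N_diag l_def)
  have "L Z = L Z ** ((\<Sum>k<l. a k *\<^sub>R G Z Z k) + a l *\<^sub>R G Z Z l)"
    using L_idem[OF assms(1)] a by simp
  also have "\<dots> = (\<Sum>k<l. a k *\<^sub>R (L Z ** G Z Z k)) + a l *\<^sub>R (L Z ** G Z Z l)"
    by (simp add: matrix_add_ldistrib matrix_mult_sum_right matrix_mult_scaleR_right)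
  also have "(\<Sum>k<l. a k *\<^sub>R (L Z ** G Z Z k)) = 0"
    using assms by (intro sum.neutral) (auto simp: L_mult_G l_def)
  finally have La: "L Z = a l *\<^sub>R G Z Z l" using LG by simp
  have "G Z Z l ** G Z Z l = G Z Z l" using G[of l] by simp
  then have "L Z ** L Z = a l *\<^sub>R (a l *\<^sub>R G Z Z l)"
    unfolding La by (simp add: matrix_mult_scaleR_right matrix_mult_scaleR_left)
  then have "L Z = a l *\<^sub>R L Z" using L_idem[OF assms(1)] La by simp
  then have "a l = 1" using L_nz[OF assms(1)] by (metis scaleR_cancel_right scaleR_one)
  then show ?thesis using La by (simp add: l_def)
qed

text \<open>If \<open>Suc (s Z Z)\<close> were below \<open>s Z W\<close>, then \<open>L Z\<close>
  would fix the nonzero matrix \<open>G Z W (Suc (s Z Z))\<close>, while in its form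
  \<open>G Z Z (s Z Z)\<close> it would annihilate it.\<close>

lemma s_le_Suc: assumes "Z \<in> \<F>" "W \<in> \<F>" shows "s Z W \<le> Suc (s Z Z)"
proof (rule ccontr)
  assume "\<not> s Z W \<le> Suc (s Z Z)"
  then have m: "Suc (s Z Z) < s Z W" "Suc (s Z Z) < s W Z" using s_commute[of W Z] by auto
  have "W \<noteq> Z" using m by auto
  have "Suc (s Z Z) + Suc (s Z Z) \<le> \<tau> Z" using s_bound[OF assms(2,1,2) m(2,1)] .
  then have "G Z Z (s Z Z) ** G Z W (Suc (s Z Z)) = 0"
    using assms s_le[of Z W] m by (simp add: G_mult)
  moreover have "L Z ** G Z W (Suc (s Z Z)) = G Z W (Suc (s Z Z))"
    using assms m by (simp add: L_mult_G)
  moreover have "L Z = G Z Z (s Z Z)" using L_eq_G[OF assms] m by simp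
  ultimately show False
    using G_nz[OF assms, of "Suc (s Z Z)"] m N_offdiag[OF assms] \<open>W \<noteq> Z\<close> by simp
qed

section \<open>The matrix units \<open>F\<close>\<close>

lemma F_eq_G: "l < s Z W \<Longrightarrow> F Z W l = G Z W l"
  by (auto simp: F_def)

lemma F_last: "F Z Z (s Z Z) = L Z"
  by (simp add: F_def)

lemma N_commute: "\<lbrakk>Z \<in> \<F>; W \<in> \<F>\<rbrakk> \<Longrightarrow> N Z W = N W Z"
  by (simp add: N_eq s_commute)

lemma less_N_cases:
  assumes "Z \<in> \<F>" "W \<in> \<F>" "l < N Z W"
  obtains "l < s Z W" | "W = Z" "l = s Z Z"
  using assms by (auto simp: N_eq less_Suc_eq split: if_splits)

lemma F_transpose: assumes "Z \<in> \<F>" "W \<in> \<F>" "l < N Z W" shows "transpose (F Z W l) = F W Z l"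
proof -
  have "l \<le> d" using assms N_le[of Z W] by simp
  then show ?thesis using L_transpose G_transpose by (auto simp: F_def)
qed

text \<open>The condition \<open>s Z Z \<le> m\<close> of \<open>L_mult_G\<close> becomes an
  equality because \<open>s_le_Suc\<close> leaves no larger index.\<close>

lemma L_mult_F:
  assumes "Z \<in> \<F>" "V \<in> \<F>" "m < N Z V"
  shows "L Z ** F Z V m = (if m = s Z Z then F Z V m else 0)"
  using assms
proof (cases rule: less_N_cases)
  case 1
  have "s Z Z \<le> m \<longleftrightarrow> m = s Z Z" if "Z \<noteq> V"
    using s_le_Suc[OF assms(1,2)] 1 by auto
  then show ?thesis using 1 L_mult_G[OF assms(1,2) 1] by (cases "Z = V") (auto simp: F_eq_G)
next
  case 2
  then show ?thesis using L_idem[OF assms(1)] by (simp add: F_last)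
qed

text \<open>For two factors of type \<open>G\<close> the product \<open>G Z V l\<close> has to be
  recognised as \<open>F Z V l\<close> with \<open>l\<close> in range. If
  \<open>Z \<noteq> V\<close> this is \<open>s_triangle\<close>; if \<open>Z = V\<close>, then
  either \<open>l < s Z Z\<close> or \<open>l = s Z Z\<close>, where \<open>L_eq_G\<close>
  identifies it with \<open>L Z\<close>. The remaining cases have a factor \<open>L\<close>.\<close>

lemma F_mult:
  assumes "Z \<in> \<F>" "W \<in> \<F>" "V \<in> \<F>" "l < N Z W" "m < N W V"
  shows "F Z W l ** F W V m = (if l = m then F Z V l else 0) \<and> (l = m \<longrightarrow> l < N Z V)"
  using assms(1,2,4)
proof (cases rule: less_N_cases)
  case l: 1
  show ?thesis using assms(2,3,5)
  proof (cases rule: less_N_cases)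
    case m: 1
    have FG: "F Z V l = G Z V l \<and> l < N Z V" if "l = m"
    proof (cases "Z = V")
      case True
      show ?thesis
      proof (cases "l < s Z Z")
        case True
        then show ?thesis using \<open>Z = V\<close> assms by (simp add: F_eq_G N_diag)
      next
        case False
        then have "l = s Z Z" using s_le_Suc[OF assms(1,2)] l by simp
        then show ?thesis using L_eq_G[OF assms(1,2)] l \<open>Z = V\<close> assms by (simp add: F_last N_diag)
      qed
    next
      case False
      then have "l < s Z V" using s_triangle[OF assms(1-3)] l m that by simp
      then show ?thesis using s_le_N[OF assms(1,3)] by (simp add: F_eq_G)
    qed
    have "F Z W l ** F W V m = (if l = m then G Z V l else 0)"
      using assms l m by (simp add: F_eq_G G_mult_s)
    then show ?thesis using FG by auto
  next
    case m: 2
    \<comment> \<open>Multiplication by \<open>L W\<close> on the right is reduced to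
      \<open>L_mult_F\<close> by transposition.\<close>
    have "transpose (L W ** F W Z l) = F Z W l ** L W"
      using F_transpose[OF assms(2,1)] N_commute[OF assms(1,2)] assms(4)
      by (simp add: matrix_transpose_mul L_transpose)
    moreover have "L W ** F W Z l = (if l = s W W then F W Z l else 0)"
      using L_mult_F[OF assms(2,1)] N_commute[OF assms(1,2)] assms(4) by simp
    ultimately have "F Z W l ** L W = (if l = s W W then F Z W l else 0)"
      using F_transpose[OF assms(2,1)] N_commute[OF assms(1,2)] assms(4)
      by (auto simp: vec_eq_iff transpose_def)
    then show ?thesis using m assms by (auto simp: F_last)
  qed
next
  case 2
  then show ?thesis using L_mult_F[OF assms(1,3)] assms by (auto simp: F_last)
qed

lemma F_in_block:
  assumes "Z \<in> \<F>" "W \<in> \<F>" "l < N Z W"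
  shows "F Z W l \<in> span (adjacency ` block Z W)"
  using L_in_block[OF assms(1)] G_in_block[OF assms(1,2), of l] assms N_le[of Z W] by (auto simp: F_def)

lemma F_nz: "\<lbrakk>Z \<in> \<F>; W \<in> \<F>; l < N Z W\<rbrakk> \<Longrightarrow> F Z W l \<noteq> 0"
  by (simp add: F_def G_nz L_nz)

lemma F_outside: "x \<notin> Z \<or> y \<notin> W \<Longrightarrow> F Z W l $ x $ y = 0"
  by (auto simp: F_def L_def G_nth sum_matrix_nth)

text \<open>The inner product is the trace of \<open>F Z W l ** F W Z m\<close>, which the product
  rule makes zero.\<close>

lemma F_inner_block:
  assumes "Z \<in> \<F>" "W \<in> \<F>" "l < N Z W" "m < N Z W" "l \<noteq> m"
  shows "F Z W l \<bullet> F Z W m = 0"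
proof -
  have "F Z W l ** F W Z m = 0"
    using F_mult[OF assms(1,2,1), of l m] assms N_commute[OF assms(1,2)] by simp
  then show ?thesis using assms by (simp add: inner_matrix_trace F_transpose trace_def)
qed

lemma F_inner:
  assumes "Z \<in> \<F>" "W \<in> \<F>" "l < N Z W" "Z' \<in> \<F>" "W' \<in> \<F>" "l' < N Z' W'" "(Z, W, l) \<noteq> (Z', W', l')"
  shows "F Z W l \<bullet> F Z' W' l' = 0"
proof (cases "Z = Z' \<and> W = W'")
  case True
  then show ?thesis using F_inner_block assms by auto
next
  case False
  have "F Z W l $ x $ y = 0 \<or> F Z' W' l' $ x $ y = 0" for x y
    using F_outside[of x Z y W l] F_outside[of x Z' y W' l'] False disj[of Z Z'] disj[of W W'] assms by blast
  then have z: "F Z W l $ x $ y * F Z' W' l' $ x $ y = 0" for x y by simp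
  show ?thesis by (simp add: inner_vec_def z)
qed

text \<open>For \<open>s Z W > 0\<close> this is the normalisation of \<open>E 0\<close>. Otherwise
  \<open>W = Z\<close> and only the diagonal relation meets \<open>Z \<times> Z\<close>, so
  \<open>Z\<close> is a single point and \<open>L Z\<close> is its identity matrix.\<close>

lemma F_0:
  assumes "Z \<in> \<F>" "W \<in> \<F>"
  shows "F Z W 0 = (1 / sqrt (real (card Z) * real (card W))) *\<^sub>R adjacency (Z \<times> W)"
  using assms N_pos[OF assms]
proof (cases rule: less_N_cases)
  case 1
  then show ?thesis using assms FF_subset card_X_pos
    by (auto simp: F_eq_G vec_eq_iff G_nth E_0 \<gamma>_def subset_iff)
next
  case 2
  have eq: "x = y" if "x \<in> Z" "y \<in> Z" for x y
  proof -
    obtain i where i: "i \<le> d" "(x, y) \<in> R i" using R_ex FF_subset[OF assms(1)] \<open>x \<in> Z\<close> \<open>y \<in> Z\<close> by blast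
    have "rel_indices d R Z Z = {}" using 2 by (simp add: s_def rel_indices_def)
    then have "i \<notin> rel_indices d R Z Z" by simp
    then have "i = 0" using i that by (cases i) (auto simp: rel_indices_def)
    then show ?thesis using i R_0 by auto
  qed
  obtain x where "x \<in> Z" using FF_nonempty[OF assms(1)] by blast
  then have "Z = {x}" using eq by blast
  then show ?thesis using 2 F_last[of Z] by (auto simp: L_def vec_eq_iff)
qed

lemma F_basis:
  assumes "Z \<in> \<F>" "W \<in> \<F>"
  shows "family_basis (F Z W) {..<N Z W} (span (adjacency ` block Z W))"
proof -
  have ind: "inj_on (F Z W) {..<N Z W}" "independent (F Z W ` {..<N Z W})"
    by (rule orthogonal_family_independent; simp add: F_inner_block[OF assms] F_nz[OF assms])+
  have "dim (span (F Z W ` {..<N Z W})) = dim (span (adjacency ` block Z W))"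
    using dim_eq_card_independent[OF ind(2)] card_image[OF ind(1)] dim_block[of Z W] by simp
  moreover have "F Z W ` {..<N Z W} \<subseteq> span (adjacency ` block Z W)" using F_in_block assms by auto
  ultimately have "span (F Z W ` {..<N Z W}) = span (adjacency ` block Z W)"
    using dim_eq_span[of "F Z W ` {..<N Z W}" "span (adjacency ` block Z W)"] by simp
  then show ?thesis using ind by (simp add: family_basis_def)
qed

lemma span_F: "\<lbrakk>Z \<in> \<F>; W \<in> \<F>\<rbrakk> \<Longrightarrow> span (F Z W ` {..<N Z W}) = span (adjacency ` block Z W)"
  using F_basis by (simp add: family_basis_def)

text \<open>The product rule settles the case of the spanning matrices \<open>F\<close>; constancy
  of the intersection numbers rests on this.\<close>

lemma block_mult:
  assumes "Z \<in> \<F>" "W \<in> \<F>" "V \<in> \<F>"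
    and "M \<in> span (adjacency ` block Z W)" "M' \<in> span (adjacency ` block W V)"
  shows "M ** M' \<in> span (adjacency ` block Z V)"
proof (rule span_mult_closed[of "F Z W ` {..<N Z W}" "F W V ` {..<N W V}"])
  fix a b assume "a \<in> F Z W ` {..<N Z W}" "b \<in> F W V ` {..<N W V}"
  then obtain l m where "l < N Z W" "m < N W V" "a = F Z W l" "b = F W V m" by auto
  then show "a ** b \<in> span (adjacency ` block Z V)"
    using F_mult[OF assms(1-3), of l m] F_in_block[OF assms(1,3)] by (auto simp: span_zero)
qed (use assms span_F in auto)

section \<open>Degrees and Krein numbers of \<open>F\<close>\<close>

lemma F_degree:
  assumes "Z \<in> \<F>" "W \<in> \<F>" "l < N Z W"
  shows "\<exists>f. degree f = l \<and> f \<noteq> 0 \<and> F Z W l = Pol Z W f"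
  using assms
proof (cases rule: less_N_cases)
  case 1
  have "l \<le> d" using assms N_le[of Z W] by simp
  then show ?thesis
    using 1 \<gamma>_pos[OF assms(1,2)] assms p_degree p_nz
    by (intro exI[of _ "smult (\<gamma> Z W) (p l)"]) (auto simp: F_eq_G G_Pol FF_subset)
next
  case 2
  note Z = assms(1)
  have d: "j \<le> d" if "j \<le> l" for j using that 2 s_le[of Z Z] by simp
  obtain a where "L Z = (\<Sum>j<N Z Z. a j *\<^sub>R G Z Z j)"
    using block_coefficients[OF Z Z L_in_block[OF Z]] by blast
  then have a: "L Z = (\<Sum>j<l. a j *\<^sub>R G Z Z j) + a l *\<^sub>R G Z Z l"
    using Z 2 by (simp add: N_diag)
  \<comment> \<open>The top coefficient decides the degree of \<open>L Z\<close>. Without it,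
    \<open>L Z\<close> would be a combination of the lower \<open>F Z Z j\<close>, to all of which
    it is orthogonal.\<close>
  have "a l \<noteq> 0"
  proof
    assume "a l = 0"
    then have "L Z \<bullet> L Z = (\<Sum>j<l. a j * (F Z Z l \<bullet> F Z Z j))"
      using 2 by (subst (2) a) (simp add: inner_sum_right F_last F_eq_G)
    also have "\<dots> = 0" using Z 2 by (intro sum.neutral) (auto simp: F_inner_block N_diag)
    finally show False using L_nz[OF Z] by simp
  qed
  define g where "g = (\<Sum>j<l. smult (a j * \<gamma> Z Z) (p j))"
  define f where "f = g + smult (a l * \<gamma> Z Z) (p l)"
  have "coeff g l = 0"
    unfolding g_def coeff_sum using d p_degree by (intro sum.neutral) (auto simp: coeff_eq_0)
  moreover have "coeff (p l) l \<noteq> 0" using p_degree[OF d] p_nz[OF d] by (metis leading_coeff_0_iff order_refl)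
  ultimately have "coeff f l \<noteq> 0" using \<open>a l \<noteq> 0\<close> \<gamma>_pos[OF Z Z] by (simp add: f_def)
  moreover have "degree f \<le> l"
    unfolding f_def g_def using d
    by (intro degree_add_le degree_sum_le) (auto intro: order_trans[OF degree_smult_le] simp: p_degree)
  ultimately have "degree f = l" "f \<noteq> 0" by (auto intro: antisym le_degree)
  moreover have "L Z = Pol Z Z f"
    unfolding a f_def g_def Pol_add Pol_sum using d FF_subset[OF Z]
    by (auto simp: G_Pol Pol_smult intro!: arg_cong2[of _ _ _ _ "(+)"] sum.cong)
  ultimately show ?thesis using 2 F_last[of Z] by auto
qed

lemma F_Q_polynomial:
  assumes "Z \<in> \<F>" "W \<in> \<F>"
  shows "Q_polynomial_basis (1 / sqrt (real (card Z) * real (card W))) (N Z W - 1) (F Z W)"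
proof -
  define c where "c = 1 / sqrt (real (card Z) * real (card W))"
  define r where "r = N Z W - 1"
  have r: "l < N Z W \<longleftrightarrow> l \<le> r" for l using N_pos[OF assms] by (auto simp: r_def)
  have c: "c \<noteq> 0" using FF_nonempty assms by (simp add: c_def)
  have orth: "F Z W l \<bullet> F Z W m = 0" if "l \<le> r" "m \<le> r" "l \<noteq> m" for l m
    using F_inner_block[OF assms] that by (simp add: r)
  have nz: "F Z W l \<bullet> F Z W l \<noteq> 0" if "l \<le> r" for l
    using F_nz[OF assms] that by (simp add: r)
  have expand: "(\<Sum>n\<in>I. b n *\<^sub>R F Z W n) \<bullet> F Z W m = (if m \<in> I then b m * (F Z W m \<bullet> F Z W m) else 0)"
    if "I \<subseteq> {..r}" "m \<le> r" for I b m
  proof -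
    have "finite I" using that(1) finite_subset by blast
    have "(\<Sum>n\<in>I. b n *\<^sub>R F Z W n) \<bullet> F Z W m = (\<Sum>n\<in>I. if n = m then b m * (F Z W m \<bullet> F Z W m) else 0)"
      unfolding inner_sum_left using that orth by (intro sum.cong) auto
    then show ?thesis using \<open>finite I\<close> by simp
  qed
  have "\<forall>l\<in>{..r}. \<exists>f. degree f = l \<and> f \<noteq> 0 \<and> F Z W l = Pol Z W f"
    using F_degree[OF assms] r by auto
  then obtain P where P: "\<And>l. l \<le> r \<Longrightarrow> degree (P l) = l \<and> P l \<noteq> 0"
    "\<And>l. l \<le> r \<Longrightarrow> F Z W l = Pol Z W (P l)"
    unfolding bchoice_iff by auto
  \<comment> \<open>These are the coefficients with respect to an orthogonal basis, with the
    normalisation \<open>c\<close> divided out.\<close>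
  define q where "q l m n = (F Z W l * F Z W m) \<bullet> F Z W n / (c * (F Z W n \<bullet> F Z W n))" for l m n
  have "F Z W l * F Z W m = c *\<^sub>R (\<Sum>n\<le>r. q l m n *\<^sub>R F Z W n)" if "l \<le> r" "m \<le> r" for l m
  proof -
    have "{..<N Z W} = {..r}" using r by auto
    moreover have "F Z W l * F Z W m \<in> span (F Z W ` {..<N Z W})"
      using Pol_in_block[of Z W "P l * P m"] that P(2) assms by (simp add: span_F Pol_mult FF_subset)
    ultimately obtain b where b: "F Z W l * F Z W m = (\<Sum>n\<le>r. b n *\<^sub>R F Z W n)"
      using mem_span_image_finite[of "{..r}" _ "F Z W"] by auto
    have "c * q l m n = b n" if "n \<le> r" for n
      using expand[of "{..r}" n b] that c nz[OF that] by (simp add: q_def b)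
    then have "(\<Sum>n\<le>r. b n *\<^sub>R F Z W n) = (\<Sum>n\<le>r. c *\<^sub>R (q l m n *\<^sub>R F Z W n))"
      by (intro sum.cong) auto
    then show ?thesis unfolding b by (simp add: scaleR_sum_right)
  qed
  moreover have "tridiagonal_nonzero r (q 1)"
  proof -
    \<comment> \<open>The product of \<open>F Z W 1\<close> and \<open>F Z W m\<close> has degree
      exactly \<open>m + 1\<close>, so its expansion ends there with a nonzero coefficient. The
      assumption \<open>m < n \<le> r\<close> puts the index 1 in range; for \<open>r = 0\<close>
      there is no such pair.\<close>
    have up: "(F Z W 1 * F Z W m) \<bullet> F Z W n = 0 \<longleftrightarrow> n \<noteq> Suc m" if "m < n" "n \<le> r" for m n
    proof -
      have "Suc m \<le> r" "1 \<le> r" "m \<le> r" using that by auto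
      define f where "f = P 1 * P m"
      have deg: "degree f = Suc m" "f \<noteq> 0"
        using P(1)[OF \<open>1 \<le> r\<close>] P(1)[OF \<open>m \<le> r\<close>] by (auto simp: f_def degree_mult_eq)
      have "\<exists>a. f = (\<Sum>j\<le>Suc m. smult (a j) (P j)) \<and> a (Suc m) = coeff f (Suc m) / lead_coeff (P (Suc m))"
        using P(1) \<open>Suc m \<le> r\<close> deg by (intro poly_graded_basis) auto
      then obtain a where a: "f = (\<Sum>j\<le>Suc m. smult (a j) (P j))"
        "a (Suc m) = coeff f (Suc m) / lead_coeff (P (Suc m))"
        by blast
      have "coeff f (Suc m) \<noteq> 0" using deg by (metis leading_coeff_0_iff)
      moreover have "lead_coeff (P (Suc m)) \<noteq> 0"
        using P(1)[OF \<open>Suc m \<le> r\<close>] unfolding leading_coeff_0_iff by blast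
      ultimately have nza: "a (Suc m) \<noteq> 0" unfolding a(2) divide_eq_0_iff by blast
      have "F Z W 1 * F Z W m = Pol Z W f"
        using P(2) \<open>1 \<le> r\<close> \<open>m \<le> r\<close> by (simp add: f_def Pol_mult)
      also have "\<dots> = (\<Sum>j\<le>Suc m. a j *\<^sub>R F Z W j)"
        unfolding a(1) Pol_sum using P(2) \<open>Suc m \<le> r\<close> by (intro sum.cong) (auto simp: Pol_smult)
      finally have "(F Z W 1 * F Z W m) \<bullet> F Z W n = (if n \<in> {..Suc m} then a n * (F Z W n \<bullet> F Z W n) else 0)"
        using expand[of "{..Suc m}" n a] that \<open>Suc m \<le> r\<close> by auto
      moreover have "n \<le> Suc m \<longleftrightarrow> n = Suc m" using that by auto
      ultimately show ?thesis using nza nz[OF \<open>n \<le> r\<close>] by auto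
    qed
    \<comment> \<open>This carries the result from above the diagonal to below it, since
      \<open>q\<close> differs from these inner products only by nonzero factors depending on
      \<open>n\<close>.\<close>
    have sym: "(F Z W 1 * F Z W m) \<bullet> F Z W n = (F Z W 1 * F Z W n) \<bullet> F Z W m" for m n
      by (simp add: inner_vec_def mult_ac)
    have q0: "q 1 m n = 0 \<longleftrightarrow> (F Z W 1 * F Z W m) \<bullet> F Z W n = 0" if "n \<le> r" for m n
      using nz[OF that] c by (simp add: q_def)
    show ?thesis unfolding tridiagonal_nonzero_def
    proof (intro allI impI)
      fix m n assume mn: "m \<le> r" "n \<le> r"
      have "q 1 m n = 0 \<longleftrightarrow> n \<noteq> Suc m" if "m < n" using up[OF that] q0 mn by simp
      moreover have "q 1 m n = 0 \<longleftrightarrow> m \<noteq> Suc n" if "n < m" using up[OF that] sym[of m n] q0 mn by simp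
      ultimately show "(Suc m < n \<or> Suc n < m \<longrightarrow> q 1 m n = 0) \<and> (n = Suc m \<or> m = Suc n \<longrightarrow> q 1 m n \<noteq> 0)"
        by auto
    qed
  qed
  ultimately show ?thesis unfolding Q_polynomial_basis_def c_def r_def by blast
qed

section \<open>The coherent configuration and its fibers\<close>

definition \<R> :: "('a \<times> 'a) set set" where "\<R> = (\<Union>Z\<in>\<F>. \<Union>W\<in>\<F>. block Z W)"

lemma \<R>_cases:
  assumes "A \<in> \<R>"
  obtains Z W where "Z \<in> \<F>" "W \<in> \<F>" "A \<in> block Z W" "A \<noteq> {}" "A \<subseteq> Z \<times> W"
proof -
  obtain Z W where ZW: "Z \<in> \<F>" "W \<in> \<F>" "A \<in> block Z W" using assms unfolding \<R>_def by blast
  moreover have "A \<noteq> {}" using ZW(3) block_nonempty by metis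
  moreover have "A \<subseteq> Z \<times> W" using ZW(3) unfolding block_def by blast
  ultimately show ?thesis by (rule that)
qed

lemma fiber_unique: "\<lbrakk>Z \<in> \<F>; W \<in> \<F>; x \<in> Z; x \<in> W\<rbrakk> \<Longrightarrow> Z = W"
  using disj by blast

lemma rels_between_\<R>: assumes "Z \<in> \<F>" "W \<in> \<F>" shows "rels_between \<R> Z W = block Z W"
proof
  show "rels_between \<R> Z W \<subseteq> block Z W"
  proof
    fix A assume "A \<in> rels_between \<R> Z W"
    then have A: "A \<in> \<R>" "A \<subseteq> Z \<times> W" by (auto simp: rels_between_def)
    from A(1) obtain Z' W' where ZW: "Z' \<in> \<F>" "W' \<in> \<F>" "A \<in> block Z' W'" "A \<noteq> {}" "A \<subseteq> Z' \<times> W'"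
      by (rule \<R>_cases)
    then obtain x y where "x \<in> Z" "x \<in> Z'" "y \<in> W" "y \<in> W'" using A(2) by fast
    then have "Z = Z'" "W = W'" using fiber_unique assms ZW by blast+
    then show "A \<in> block Z W" using ZW by simp
  qed
  show "block Z W \<subseteq> rels_between \<R> Z W"
    using assms unfolding rels_between_def \<R>_def block_def by blast
qed

lemma r_tilde_\<R>: "\<lbrakk>Z \<in> \<F>; W \<in> \<F>\<rbrakk> \<Longrightarrow> r_tilde \<R> Z W = N Z W - 1"
  by (simp add: r_tilde_def rels_between_\<R> card_block)

lemma le_r_tilde: "\<lbrakk>Z \<in> \<F>; W \<in> \<F>\<rbrakk> \<Longrightarrow> l \<le> r_tilde \<R> Z W \<longleftrightarrow> l < N Z W"
  using N_pos[of Z W] by (auto simp: r_tilde_\<R>)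

text \<open>A diagonal pair in \<open>Id_on A\<close> forces the index 0 and \<open>Z = W\<close>,
  so \<open>A\<close> is a whole member of the family.\<close>

lemma fibers_\<R>: "fibers \<R> = \<F>"
proof
  show "fibers \<R> \<subseteq> \<F>"
  proof
    fix A assume "A \<in> fibers \<R>"
    then have A: "A \<noteq> {}" "Id_on A \<in> \<R>" by (auto simp: fibers_def)
    from A(2) obtain Z W where ZW: "Z \<in> \<F>" "W \<in> \<F>" "Id_on A \<in> block Z W" "Id_on A \<subseteq> Z \<times> W"
      by (rule \<R>_cases)
    then obtain i where i: "i \<le> d" "Id_on A = R i \<inter> (Z \<times> W)" by (auto simp: block_def \<Lambda>_def)
    obtain x where x: "x \<in> A" using A by blast
    then have "(x, x) \<in> R i" "x \<in> Z" "x \<in> W" using i by auto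
    then have "Z = W" using ZW fiber_unique by blast
    have "(x, x) \<in> R 0" using \<open>x \<in> Z\<close> FF_subset[OF ZW(1)] R_0 by auto
    then have "i = 0" using R_disjoint[of i 0] i \<open>(x, x) \<in> R i\<close> by blast
    then have "Id_on A = Id_on Z" using i R_0 FF_subset[OF ZW(1)] \<open>Z = W\<close> by auto
    then have "A = Z" by (auto simp: set_eq_iff Id_on_iff)
    then show "A \<in> \<F>" using ZW by simp
  qed
  show "\<F> \<subseteq> fibers \<R>"
    using Id_in_block FF_nonempty by (auto simp: fibers_def \<R>_def)
qed

text \<open>The number of intermediate points is an entry of a product of adjacency matrices, which
  lies in the span of the block containing \<open>C\<close>. The set \<open>Y\<close> is left open
  because both the union of all fibers and a single fiber occur.\<close>

lemma block_constant_intersection: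
  assumes F: "Z \<in> \<F>" "W \<in> \<F>" "V \<in> \<F>" and "W \<subseteq> Y"
    and A: "A \<in> block Z W" "B \<in> block W V" "C \<in> block Z V"
  shows "constant_intersection Y A B C"
proof -
  have "adjacency A ** adjacency B \<in> span (adjacency ` block Z V)"
    using A by (intro block_mult[OF F]) (auto intro: span_base)
  then obtain c where c: "\<forall>(x, y)\<in>C. (adjacency A ** adjacency B) $ x $ y = c"
    unfolding mem_span_adjacency[OF block_disjoint] using A by blast
  have eq: "{z. (x, z) \<in> A \<and> (z, y) \<in> B} = {z \<in> Y. (x, z) \<in> A \<and> (z, y) \<in> B}" for x y
    using A \<open>W \<subseteq> Y\<close> by (auto simp: block_def)
  \<comment> \<open>The constant \<open>c\<close> is a real number equal to a cardinality, and
    \<open>nat\<close> of its floor recovers the latter.\<close>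
  have "card {z \<in> Y. (x, z) \<in> A \<and> (z, y) \<in> B} = nat \<lfloor>c\<rfloor>" if "(x, y) \<in> C" for x y
    using bspec[OF c that] by (auto simp: adjacency_mult_nth eq)
  then show ?thesis unfolding constant_intersection_def by blast
qed

lemma coherent_\<R>: "coherent_configuration (\<Union>\<F>) \<R>"
  unfolding coherent_configuration_def
proof (intro conjI ballI impI)
  show "partition_on (\<Union>\<F> \<times> \<Union>\<F>) \<R>"
  proof (rule partition_onI)
    have "\<Union>\<R> = (\<Union>Z\<in>\<F>. \<Union>W\<in>\<F>. \<Union>(block Z W))" by (auto simp: \<R>_def)
    also have "\<dots> = (\<Union>Z\<in>\<F>. \<Union>W\<in>\<F>. Z \<times> W)" by (simp add: Union_block FF_subset)
    also have "\<dots> = \<Union>\<F> \<times> \<Union>\<F>" by blast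
    finally show "\<Union>\<R> = \<Union>\<F> \<times> \<Union>\<F>" .
    show "{} \<notin> \<R>" using block_nonempty unfolding \<R>_def by blast
    fix A B assume AB: "A \<in> \<R>" "B \<in> \<R>" "A \<noteq> B"
    obtain Z W where A: "Z \<in> \<F>" "W \<in> \<F>" "A \<in> block Z W" "A \<subseteq> Z \<times> W" using AB(1) by (rule \<R>_cases)
    obtain Z' W' where B: "Z' \<in> \<F>" "W' \<in> \<F>" "B \<in> block Z' W'" "B \<subseteq> Z' \<times> W'" using AB(2) by (rule \<R>_cases)
    show "disjnt A B"
    proof (cases "Z = Z' \<and> W = W'")
      case True
      then show ?thesis using disjointD[OF block_disjoint[of Z W]] A B AB by (auto simp: disjnt_def)
    next
      case False
      then have "(Z \<times> W) \<inter> (Z' \<times> W') = {}" using disj[of Z Z'] disj[of W W'] A B by blast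
      then show ?thesis using A B by (auto simp: disjnt_def)
    qed
  qed
next
  fix A assume "A \<in> \<R>"
  then obtain Z W i where i: "Z \<in> \<F>" "W \<in> \<F>" "i \<le> d" "A = R i \<inter> (Z \<times> W)" "A \<noteq> {}"
    by (auto simp: \<R>_def block_def \<Lambda>_def)
  have "A\<inverse> = R i \<inter> (W \<times> Z)" using i R_sym[of i] by (auto dest: symD)
  then have "A\<inverse> \<in> block W Z" using i by (auto simp: block_def \<Lambda>_def)
  then show "A\<inverse> \<in> \<R>" using i by (auto simp: \<R>_def)
  assume "A \<inter> Id \<noteq> {}"
  then obtain x where "(x, x) \<in> R i" using i by auto
  moreover from this have "(x, x) \<in> R 0" using R_subset[of i] i R_0 by auto
  ultimately have "i = 0" using R_disjoint[of i 0] i by blast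
  then show "A \<subseteq> Id" using i R_0 by auto
next
  fix A B C assume ABC: "A \<in> \<R>" "B \<in> \<R>" "C \<in> \<R>"
  obtain Z W where A: "Z \<in> \<F>" "W \<in> \<F>" "A \<in> block Z W" "A \<subseteq> Z \<times> W" using ABC(1) by (rule \<R>_cases)
  obtain W' V where B: "W' \<in> \<F>" "V \<in> \<F>" "B \<in> block W' V" "B \<subseteq> W' \<times> V" using ABC(2) by (rule \<R>_cases)
  obtain Z' V' where C: "Z' \<in> \<F>" "V' \<in> \<F>" "C \<in> block Z' V'" "C \<subseteq> Z' \<times> V'" using ABC(3) by (rule \<R>_cases)
  show "constant_intersection (\<Union>\<F>) A B C"
  proof (cases "W = W' \<and> Z = Z' \<and> V = V'")
    case True
    then show ?thesis using A B C by (intro block_constant_intersection[of Z W V]) auto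
  next
    case False
    \<comment> \<open>If the fibers do not fit together there is no intermediate point, and the
      constant is 0.\<close>
    have "{z \<in> \<Union>\<F>. (x, z) \<in> A \<and> (z, y) \<in> B} = {}" if "(x, y) \<in> C" for x y
    proof (rule ccontr)
      assume "{z \<in> \<Union>\<F>. (x, z) \<in> A \<and> (z, y) \<in> B} \<noteq> {}"
      then obtain z where "(x, z) \<in> A" "(z, y) \<in> B" by blast
      then have "x \<in> Z" "z \<in> W" "z \<in> W'" "y \<in> V" "x \<in> Z'" "y \<in> V'" using A B C that by auto
      then show False using False fiber_unique A B C by blast
    qed
    then have "card {z \<in> \<Union>\<F>. (x, z) \<in> A \<and> (z, y) \<in> B} = 0" if "(x, y) \<in> C" for x y
      using that by simp
    then show ?thesis unfolding constant_intersection_def by blast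
  qed
qed

text \<open>A scheme needs consecutive labels starting with the diagonal, whereas
  \<open>\<Lambda> Z Z\<close> may have gaps; the renumbering \<open>g\<close> closes them and keeps
  0 in place.\<close>

lemma fiber_scheme:
  assumes Z: "Z \<in> \<F>"
  shows "\<exists>d R. sym_assoc_scheme Z d R \<and> R ` {..d} = block Z Z"
proof -
  have 0: "0 \<in> \<Lambda> Z Z" using FF_subset[OF Z] FF_nonempty[OF Z] R_0 by (auto simp: \<Lambda>_def)
  obtain h where h: "bij_betw h {1..card (\<Lambda> Z Z - {0})} (\<Lambda> Z Z - {0})"
    using ex_bij_betw_nat_finite_1[of "\<Lambda> Z Z - {0}"] finite_\<Lambda> by blast
  define k where "k = card (\<Lambda> Z Z - {0})"
  define g where "g = h(0 := 0)"
  have "bij_betw g {1..k} (\<Lambda> Z Z - {0})"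
    using h by (subst bij_betw_cong[of _ g h]) (auto simp: g_def k_def)
  moreover have "bij_betw g {0} {0}" by (simp add: g_def)
  ultimately have "bij_betw g ({1..k} \<union> {0}) ((\<Lambda> Z Z - {0}) \<union> {0})"
    by (intro bij_betw_combine) auto
  moreover have "{1..k} \<union> {0} = {..k}" "(\<Lambda> Z Z - {0}) \<union> {0} = \<Lambda> Z Z" using 0 by auto
  ultimately have g: "bij_betw g {..k} (\<Lambda> Z Z)" by simp
  define R' where "R' i = R (g i) \<inter> (Z \<times> Z)" for i
  have im: "R' ` {..k} = block Z Z"
    unfolding R'_def block_def bij_betw_imp_surj_on[OF g, symmetric] image_image by (rule refl)
  have in_block: "R' i \<in> block Z Z" if "i \<le> k" for i using im that by auto
  have "R' 0 = Id_on Z" using R_0 FF_subset[OF Z] by (auto simp: R'_def g_def)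
  moreover have "inj_on R' {..k}"
    using comp_inj_on[OF bij_betw_imp_inj_on[OF g], of "\<lambda>i. R i \<inter> (Z \<times> Z)"] inj_on_block[of Z Z]
      bij_betw_imp_surj_on[OF g] unfolding R'_def comp_def by simp
  moreover have "partition_on (Z \<times> Z) (R' ` {..k})"
    unfolding im partition_on_def using Union_block FF_subset[OF Z] block_disjoint block_nonempty by auto
  moreover have "sym (R' i)" if "i \<le> k" for i
  proof -
    have "g i \<le> d" using bij_betwE[OF g] that by (auto simp: \<Lambda>_def)
    then show ?thesis using R_sym[of "g i"] by (auto simp: R'_def sym_def)
  qed
  moreover have "constant_intersection Z (R' i) (R' j) (R' l)" if "i \<le> k" "j \<le> k" "l \<le> k" for i j l
    using that in_block by (intro block_constant_intersection[OF Z Z Z]) auto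
  ultimately have "sym_assoc_scheme Z k R'" unfolding sym_assoc_scheme_def by blast
  then show ?thesis using im by blast
qed

lemma F_total_basis:
  "family_basis (\<lambda>(Z, W, l). F Z W l) {(Z, W, l). Z \<in> \<F> \<and> W \<in> \<F> \<and> l \<le> r_tilde \<R> Z W} (span (adjacency ` \<R>))"
proof -
  define I where "I = {(Z, W, l). Z \<in> \<F> \<and> W \<in> \<F> \<and> l \<le> r_tilde \<R> Z W}"
  define f where "f = (\<lambda>(Z, W, l). F Z W l)"
  have I: "(Z, W, l) \<in> I \<longleftrightarrow> Z \<in> \<F> \<and> W \<in> \<F> \<and> l < N Z W" for Z W l
    by (auto simp: I_def le_r_tilde)
  have "f i \<bullet> f j = 0" if ij: "i \<in> I" "j \<in> I" "i \<noteq> j" for i j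
  proof -
    obtain Z W l where i: "i = (Z, W, l)" by (cases i)
    obtain Z' W' l' where j: "j = (Z', W', l')" by (cases j)
    show ?thesis using F_inner[of Z W l Z' W' l'] ij by (simp add: I f_def i j)
  qed
  moreover have "f i \<noteq> 0" if i: "i \<in> I" for i
  proof -
    obtain Z W l where "i = (Z, W, l)" by (cases i)
    then show ?thesis using i F_nz by (simp add: I f_def)
  qed
  ultimately have ind: "inj_on f I" "independent (f ` I)"
    by (rule orthogonal_family_independent; blast)+
  have fI: "F Z W ` {..<N Z W} \<subseteq> f ` I" if "Z \<in> \<F>" "W \<in> \<F>" for Z W
  proof
    fix M assume "M \<in> F Z W ` {..<N Z W}"
    then obtain l where "l < N Z W" "M = f (Z, W, l)" by (auto simp: f_def)
    moreover from this have "(Z, W, l) \<in> I" using I that by simp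
    ultimately show "M \<in> f ` I" by blast
  qed
  have "span (f ` I) = span (adjacency ` \<R>)"
  proof (rule span_eq[THEN iffD2], intro conjI subsetI)
    fix M assume "M \<in> f ` I"
    then obtain Z W l where l: "Z \<in> \<F>" "W \<in> \<F>" "l < N Z W" "M = F Z W l"
      by (auto simp: f_def I)
    then have "M \<in> span (adjacency ` block Z W)" using F_in_block by simp
    moreover have "adjacency ` block Z W \<subseteq> adjacency ` \<R>" using l by (auto simp: \<R>_def)
    ultimately show "M \<in> span (adjacency ` \<R>)"
      using span_mono[of "adjacency ` block Z W" "adjacency ` \<R>"] by blast
  next
    fix M assume "M \<in> adjacency ` \<R>"
    then obtain Z W where l: "Z \<in> \<F>" "W \<in> \<F>" "M \<in> adjacency ` block Z W" by (auto simp: \<R>_def)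
    then have "M \<in> span (F Z W ` {..<N Z W})" by (simp add: span_F span_base)
    then show "M \<in> span (f ` I)" using span_mono[OF fI[OF l(1,2)]] by blast
  qed
  then show ?thesis using ind by (simp add: family_basis_def f_def I_def)
qed

theorem Q_polynomial_\<R>: "Q_polynomial_coherent_configuration (\<Union>\<F>) \<R>"
proof -
  have le: "{..r_tilde \<R> Z W} = {..<N Z W}" if "Z \<in> \<F>" "W \<in> \<F>" for Z W
    using le_r_tilde that by auto
  have prod: "F Z W l ** F Z' W' l' = (if l = l' \<and> W = Z' then F Z W' l else 0) \<and>
      (l = l' \<and> W = Z' \<longrightarrow> l \<le> r_tilde \<R> Z W')"
    if "Z \<in> \<F>" "W \<in> \<F>" "Z' \<in> \<F>" "W' \<in> \<F>" "l \<le> r_tilde \<R> Z W" "l' \<le> r_tilde \<R> Z' W'" for Z W Z' W' l l'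
  proof (cases "W = Z'")
    case True
    then show ?thesis using F_mult[of Z W W' l l'] that by (simp add: le_r_tilde)
  next
    case False
    \<comment> \<open>\<open>W\<close> and \<open>Z'\<close> are disjoint, so no middle index lies
      in both supports.\<close>
    have z: "F Z W l $ x $ z * F Z' W' l' $ z $ y = 0" for x y z
      using F_outside[of x Z z W l] F_outside[of z Z' y W' l'] disj[of W Z'] False that by auto
    show ?thesis using False by (simp add: matrix_matrix_mult_def vec_eq_iff z)
  qed
  show ?thesis
    unfolding Q_polynomial_coherent_configuration_def fibers_\<R>
  proof (intro conjI ballI exI[of _ F] allI impI)
    fix Z assume "Z \<in> \<F>"
    then show "\<exists>d R. sym_assoc_scheme Z d R \<and> R ` {..d} = rels_between \<R> Z Z"
      using fiber_scheme by (simp add: rels_between_\<R>)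
  next
    fix Z W assume ZW: "Z \<in> \<F>" "W \<in> \<F>"
    then show "family_basis (F Z W) {..r_tilde \<R> Z W} (span (adjacency ` rels_between \<R> Z W))"
      by (simp add: le rels_between_\<R> F_basis)
    show "Q_polynomial_basis (1 / sqrt (real (card Z) * real (card W))) (r_tilde \<R> Z W) (F Z W)"
      unfolding r_tilde_\<R>[OF ZW] by (rule F_Q_polynomial[OF ZW])
    show "transpose (F Z W l) = F W Z l" if "l \<le> r_tilde \<R> Z W" for l
      using F_transpose[OF ZW] that by (simp add: le_r_tilde ZW)
  next
    fix Z W Z' W' l l'
    assume "Z \<in> \<F>" "W \<in> \<F>" "Z' \<in> \<F>" "W' \<in> \<F>" "l \<le> r_tilde \<R> Z W" "l' \<le> r_tilde \<R> Z' W'"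
    note * = prod[OF this]
    show "F Z W l ** F Z' W' l' = (if l = l' \<and> W = Z' then F Z W' l else 0)"
      by (rule conjunct1[OF *])
    show "l \<le> r_tilde \<R> Z W'" if "l = l' \<and> W = Z'"
      using conjunct2[OF *] that by (rule mp)
  qed (fact coherent_\<R> F_total_basis F_0)+
qed

end

section \<open>Passage from indexed designs to a set of fibers\<close>

theorem theorem5p5:
  fixes X :: "'a::finite set"
    and d n :: nat
    and R :: "nat \<Rightarrow> ('a \<times> 'a) set"
    and E :: "nat \<Rightarrow> real^'a^'a"
    and Xs :: "nat \<Rightarrow> 'a set"
    and t :: "nat \<Rightarrow> nat"
    and s :: "nat \<Rightarrow> nat \<Rightarrow> nat"
  assumes "Q_polynomial_scheme X d R E"
    and "\<forall>i\<in>{1..n}. is_design X d E (t i) (Xs i)"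
    and "\<forall>i\<in>{1..n}. \<forall>j\<in>{1..n}. i \<noteq> j \<longrightarrow> Xs i \<inter> Xs j = {}"
    and "\<forall>i\<in>{1..n}. \<forall>j\<in>{1..n}. s i j = card (rel_indices d R (Xs i) (Xs j))"
    and "\<forall>i\<in>{1..n}. \<forall>j\<in>{1..n}. \<forall>h\<in>{1..n}. int (s i j) + int (s j h) - 2 \<le> int (t j)"
  shows "Q_polynomial_coherent_configuration
           (\<Union>i\<in>{1..n}. Xs i)
           ({Id_on (Xs i) | i. i \<in> {1..n}} \<union>
            {R \<alpha> \<inter> (Xs i \<times> Xs j) | \<alpha> i j.
               i \<in> {1..n} \<and> j \<in> {1..n} \<and> \<alpha> \<in> rel_indices d R (Xs i) (Xs j)})"
proof -
  interpret Q_scheme X d R E by (rule Q_scheme.intro) (rule assms(1))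
  have nonempty: "Xs i \<noteq> {}" and subset: "Xs i \<subseteq> X" if "i \<in> {1..n}" for i
    using assms(2) that by (auto simp: is_design_def)
  \<comment> \<open>Nonempty disjoint sets are distinct, so the strength can be read as a function
    \<open>\<tau>\<close> of the set instead of its index.\<close>
  have inj: "inj_on Xs {1..n}"
  proof (rule inj_onI, rule ccontr)
    fix i j assume ij: "i \<in> {1..n}" "j \<in> {1..n}" "Xs i = Xs j" "i \<noteq> j"
    then have "Xs i \<inter> Xs j = {}" using assms(3) by blast
    then show False using nonempty ij by simp
  qed
  define \<tau> where "\<tau> Z = t (the_inv_into {1..n} Xs Z)" for Z
  have \<tau>: "\<tau> (Xs i) = t i" if "i \<in> {1..n}" for i
    using the_inv_into_f_f[OF inj that] by (simp add: \<tau>_def)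
  obtain T p where T: "T \<in> BM"
    and T_sep: "\<forall>i\<le>d. \<forall>x\<in>X. \<forall>y\<in>X. \<forall>x'\<in>X. \<forall>y'\<in>X.
      T $ x $ y = T $ x' $ y' \<longrightarrow> (x, y) \<in> R i \<longrightarrow> (x', y') \<in> R i"
    and p: "\<forall>l\<le>d. degree (p l) = l \<and> p l \<noteq> 0"
      "\<forall>l\<le>d. \<forall>x\<in>X. \<forall>y\<in>X. E l $ x $ y = poly (p l) (T $ x $ y)"
    using polynomial_structure by blast
  interpret design_family X d R E "Xs ` {1..n}" \<tau> T p
  proof unfold_locales
    show "is_design X d E (\<tau> Z) Z" if "Z \<in> Xs ` {1..n}" for Z
      using that assms(2) \<tau> by auto
    show "Z \<inter> W = {}" if ZW: "Z \<in> Xs ` {1..n}" "W \<in> Xs ` {1..n}" "Z \<noteq> W" for Z W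
    proof -
      obtain i j where ij: "i \<in> {1..n}" "j \<in> {1..n}" "Z = Xs i" "W = Xs j" using ZW by blast
      then have "i \<noteq> j" using ZW(3) by auto
      then show ?thesis using bspec[OF bspec[OF assms(3) ij(1)] ij(2)] ij by simp
    qed
    show "card (rel_indices d R Z W) + card (rel_indices d R W V) \<le> \<tau> W + 2"
      if ZWV: "Z \<in> Xs ` {1..n}" "W \<in> Xs ` {1..n}" "V \<in> Xs ` {1..n}" for Z W V
    proof -
      obtain i j h where ijh: "i \<in> {1..n}" "j \<in> {1..n}" "h \<in> {1..n}" "Z = Xs i" "W = Xs j" "V = Xs h"
        using ZWV by blast
      then have "int (s i j) + int (s j h) - 2 \<le> int (t j)"
        and "s i j = card (rel_indices d R Z W)" "s j h = card (rel_indices d R W V)"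
        using bspec[OF bspec[OF bspec[OF assms(5)]]] bspec[OF bspec[OF assms(4)]] by simp_all
      then show ?thesis using \<tau>[of j] ijh by simp
    qed
    show "T \<in> BM" by (rule T)
    show "(x', y') \<in> R i"
      if "i \<le> d" "x \<in> X" "y \<in> X" "x' \<in> X" "y' \<in> X" "T $ x $ y = T $ x' $ y'" "(x, y) \<in> R i"
      for i x y x' y'
      using T_sep that by blast
  qed (use p in simp_all)
  \<comment> \<open>The index 0 accounts for the diagonal relations, since a nonempty intersection
    of \<open>R 0\<close> with \<open>Xs i \<times> Xs j\<close> forces \<open>i = j\<close>; all
    other indices lie in \<open>rel_indices\<close>.\<close>
  have "\<R> = {Id_on (Xs i) | i. i \<in> {1..n}} \<union>
    {R \<alpha> \<inter> (Xs i \<times> Xs j) | \<alpha> i j. i \<in> {1..n} \<and> j \<in> {1..n} \<and> \<alpha> \<in> rel_indices d R (Xs i) (Xs j)}"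
    (is "_ = ?I \<union> ?A")
  proof (rule subset_antisym)
    show "\<R> \<subseteq> ?I \<union> ?A"
    proof
      fix A assume "A \<in> \<R>"
      then obtain i j \<alpha> where A: "i \<in> {1..n}" "j \<in> {1..n}" "\<alpha> \<le> d" "R \<alpha> \<inter> (Xs i \<times> Xs j) \<noteq> {}"
        "A = R \<alpha> \<inter> (Xs i \<times> Xs j)"
        unfolding \<R>_def block_def \<Lambda>_def by blast
      show "A \<in> ?I \<union> ?A"
      proof (cases "\<alpha> = 0")
        case True
        then obtain x where "x \<in> Xs i" "x \<in> Xs j" using A R_0 by auto
        then have "i = j" using A assms(3) by blast
        then have "A = Id_on (Xs i)" using True A R_0 subset by auto
        then show ?thesis using A by blast
      next
        case False
        then have "\<alpha> \<in> rel_indices d R (Xs i) (Xs j)" using A by (simp add: rel_indices_def)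
        then show ?thesis using A by blast
      qed
    qed
    have "?I \<subseteq> \<R>" unfolding \<R>_def using Id_in_block by blast
    moreover have "?A \<subseteq> \<R>"
    proof
      fix A assume "A \<in> ?A"
      then obtain i j \<alpha> where A: "i \<in> {1..n}" "j \<in> {1..n}" "\<alpha> \<in> rel_indices d R (Xs i) (Xs j)"
        "A = R \<alpha> \<inter> (Xs i \<times> Xs j)"
        by blast
      then have "\<alpha> \<in> \<Lambda> (Xs i) (Xs j)" by (simp add: \<Lambda>_def rel_indices_def)
      then have "A \<in> block (Xs i) (Xs j)" unfolding block_def A(4) by (rule imageI)
      then show "A \<in> \<R>" unfolding \<R>_def using A(1,2) by blast
    qed
    ultimately show "?I \<union> ?A \<subseteq> \<R>" by blast
  qed
  then show ?thesis using Q_polynomial_\<R> by (simp only:)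
qed

end
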